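(* Let $p\in[1,\infty)$ and let $X,Y,Z$ be random variables with values in $\mathbb{R}^{d_X},\mathbb{R}^{d_Y},\mathbb{R}^{d_Z}$ on a common probability space, where the law $\mathcal{L}_Z$ of $Z$ is compactly supported. Suppose that $z\mapsto\mathcal{L}_{(X,Y)|Z=z}$ is $L_{XY}$-Lipschitz with respect to $W_p$, and that $z\mapsto\mathcal{L}_{X|Z=z}$ and $z\mapsto\mathcal{L}_{Y|Z=z}$ are $L_X$- and $L_Y$-Lipschitz, respectively, with respect to $W_p$ (as maps on $\mathrm{supp}(\mathcal{L}_Z)$). Let $\varepsilon>0$. Suppose that $\{V_j\}_{j=1}^J$ is a measurable partition of $\mathrm{supp}(\mathcal{L}_Z)$ and that for every bin $V_j$, $$\mathrm{diam}(V_j)\le\frac{\varepsilon}{4\max\left\{L_{XY},\left(2^{p-1}(L_X^p+L_Y^p)\right)^{1/p}\right\}}.$$ Then for every $j\in\{1,\dots,J\}$ and every $z_0\in V_j$, $$\left|W_p\left(\mathcal{L}_{(X,Y)|Z=z_0},\mathcal{L}_{X|Z=z_0}\otimes\mathcal{L}_{Y|Z=z_0}\right)-W_p\left(\mathcal{L}_{(X,Y)|Z\in V_j},\mathcal{L}_{X|Z\in V_j}\otimes\mathcal{L}_{Y|Z\in V_j}\right)\right|\le\frac{\varepsilon}{2}.$$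
   Context: $\mathcal{P}_p(\mathbb{R}^d)$ is the set of Borel probability measures on $\mathbb{R}^d$ with finite $p$-th moment, and for $\mu,\nu\in\mathcal{P}_p(\mathbb{R}^d)$, $W_p(\mu,\nu)=\inf_{\gamma\in\Pi(\mu,\nu)}\left(\int\|x-y\|^p\,d\gamma(x,y)\right)^{1/p}$, where $\Pi(\mu,\nu)$ is the set of couplings of $\mu,\nu$ and $\|\cdot\|$ is the Euclidean norm. $\mathcal{L}_{(X,Y)|Z=z}$, $\mathcal{L}_{X|Z=z}$, $\mathcal{L}_{Y|Z=z}$ denote (fixed versions of) the regular conditional distributions of $(X,Y)$, $X$, $Y$ given $Z=z$, defined for $z\in\mathrm{supp}(\mathcal{L}_Z)$ and taking values in $\mathcal{P}_p$. A map $z\mapsto\mu_z$ is $L$-Lipschitz with respect to $W_p$ if $W_p(\mu_z,\mu_{z'})\le L|z-z'|$ for all $z,z'\in\mathrm{supp}(\mathcal{L}_Z)$. Each bin satisfies $\mathcal{L}_Z(V_j)>0$, and $\mathcal{L}_{(X,Y)|Z\in V_j}$ is the law of $(X,Y)$ conditioned on the event $\{Z\in V_j\}$, i.e. $\frac{1}{\mathcal{L}_Z(V_j)}\int_{V_j}\mathcal{L}_{(X,Y)|Z=z}\,d\mathcal{L}_Z(z)$; similarly for $\mathcal{L}_{X|Z\in V_j}$ and $\mathcal{L}_{Y|Z\in V_j}$. If the denominator in the diameter condition is $0$, the condition is regarded as void. *)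

theory Defs
  imports "HOL-Probability.Probability"
begin

definition msupport :: "'a::topological_space measure \<Rightarrow> 'a set" where
  "msupport \<mu> = {z. \<forall>U. open U \<longrightarrow> z \<in> U \<longrightarrow> emeasure \<mu> U > 0}"

definition finite_moment_measures :: "real \<Rightarrow> 'a::euclidean_space measure set" where
  "finite_moment_measures p =
     {\<mu>. sets \<mu> = sets borel \<and> prob_space \<mu> \<and> integrable \<mu> (\<lambda>x. norm x powr p)}"

definition couplings ::
    "'a::euclidean_space measure \<Rightarrow> 'a measure \<Rightarrow> ('a \<times> 'a) measure set" where
  "couplings \<mu> \<nu> =
     {\<gamma>. sets \<gamma> = sets borel \<and> prob_space \<gamma> \<and> distr \<gamma> borel fst = \<mu> \<and> distr \<gamma> borel snd = \<nu>}"

(* Intended for \<mu> and \<nu> in finite_moment_measures p with p \<ge> 1: there, every coupling has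
   finite cost and \<mu> \<Otimes>\<^sub>M \<nu> is a coupling, so this is the infimum of a nonempty set of
   nonnegative reals. Outside that domain the conventions for divergent Bochner integrals and
   for the infimum of the empty set make the value meaningless. *)
definition wasserstein ::
    "real \<Rightarrow> 'a::euclidean_space measure \<Rightarrow> 'a measure \<Rightarrow> real" where
  "wasserstein p \<mu> \<nu> =
     (INF \<gamma>\<in>couplings \<mu> \<nu>. (\<integral>xy. norm (fst xy - snd xy) powr p \<partial>\<gamma>) powr (1 / p))"

definition wasserstein_lipschitz_on ::
    "real \<Rightarrow> real \<Rightarrow> 'z::metric_space set \<Rightarrow> ('z \<Rightarrow> 'a::euclidean_space measure) \<Rightarrow> bool" where
  "wasserstein_lipschitz_on p L S \<mu> \<longleftrightarrow>
     0 \<le> L \<and> (\<forall>z\<in>S. \<forall>z'\<in>S. wasserstein p (\<mu> z) (\<mu> z') \<le> L * dist z z')"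

(* K is a version of the regular conditional distribution of X given Z. Only its values on the
   support of the law of Z matter; that support is closed, and it has full measure because the
   spaces are second countable. *)
definition regular_cond_distr ::
    "'w measure \<Rightarrow> ('w \<Rightarrow> 'a::euclidean_space) \<Rightarrow> ('w \<Rightarrow> 'z::euclidean_space) \<Rightarrow>
      ('z \<Rightarrow> 'a measure) \<Rightarrow> bool" where
  "regular_cond_distr M X Z K \<longleftrightarrow>
     K \<in> restrict_space borel (msupport (distr M borel Z)) \<rightarrow>\<^sub>M prob_algebra borel \<and>
     (\<forall>A\<in>sets borel. \<forall>B\<in>sets borel.
        emeasure M {w \<in> space M. X w \<in> A \<and> Z w \<in> B} =
          (\<integral>\<^sup>+z\<in>B \<inter> msupport (distr M borel Z). emeasure (K z) A \<partial>distr M borel Z))"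

definition law_given_event ::
    "'w measure \<Rightarrow> ('w \<Rightarrow> 'a::euclidean_space) \<Rightarrow> ('w \<Rightarrow> 'z) \<Rightarrow> 'z set \<Rightarrow> 'a measure" where
  "law_given_event M X Z V = distr (uniform_measure M (Z -` V \<inter> space M)) borel X"

end

theory Submission
  imports Defs
begin

text \<open>
  The Lipschitz bound on a bin passes from the kernel to its average because the Wasserstein
  distance to a fixed measure is quasi-convex under mixtures; the bound on the diameter then makes
  both arguments of the distance move by at most \<open>\<epsilon> / 4\<close>, and the triangle inequality concludes.

  Neither disintegration nor measurable selection of couplings is needed. For the triangle
  inequality, two couplings are glued along a partition of the common marginal into countably many
  cells of small diameter, which costs only the diameter of the cells. For mixtures, the Wasserstein
  neighbourhoods of a measure contain neighbourhoods given by finitely many test functions (the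
  masses of finitely many cells and a tail moment); the mixture is approximated in these test
  functions by a countable mixture of the kernel, along which couplings can be chosen freely.
\<close>

section \<open>Gluing and the triangle inequality\<close>

text \<open>The couplings behind a bound \<open>wasserstein_le p \<mu> (K z) r\<close> come with no
  measurability in \<open>z\<close>, so they cannot simply be integrated; and two couplings with a
  common marginal cannot be composed exactly without conditional laws. Both obstacles vanish when
  only countably many cells or labels are involved: conditioning on a cell is a density, and every
  function of a discrete label is measurable. The price is an arbitrarily small error. The strict
  slack \<open>s > r\<close> in all bounds absorbs it and also spares the existence of optimal
  couplings.

  Test functions are needed only from one side. Masses of a finite partition sum to one, so upper
  bounds alone control their total variation, and a tail moment only has to be kept from being too
  large.

  The second argument of the distance on a bin is a product of averages, not an average of products.
  The mixture estimate is therefore applied to each factor, and the product is taken afterwards. The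
  constant built from \<open>L\<^sub>X\<close> and \<open>L\<^sub>Y\<close> is what the product of
  two couplings costs: the norm of a pair is at most the sum of the norms, and the
  \<open>p\<close>-th power of that sum is split by convexity.\<close>

lemma powr_convex_combination:
  fixes p t u v :: real
  assumes "1 \<le> p" "0 \<le> t" "t \<le> 1" "0 \<le> u" "0 \<le> v"
  shows "(t * u + (1 - t) * v) powr p \<le> t * u powr p + (1 - t) * v powr p"
proof (cases "u = 0 \<or> v = 0")
  case True
  \<comment> \<open>If \<open>u\<close> or \<open>v\<close> vanishes, the claim reduces to comparing
    the power of a weight in the unit interval with the weight itself.\<close>
  have small: "s powr p \<le> s" if "0 \<le> s" "s \<le> 1" for s :: real
    using powr_mono'[of 1 p s] that assms(1) by simp
  show ?thesis
    using True small[of t] small[of "1 - t"] assms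
    by (auto simp: powr_mult intro!: mult_right_mono)
next
  case False
  then show ?thesis
    using convex_onD[OF powr_convex[OF assms(1)], of "1 - t" u v] assms by simp
qed

text \<open>Convexity with both weights equal to one half. The factor \<open>2 powr (p - 1)\<close>
  is the one that appears in the constant of the theorem.\<close>

lemma powr_add_le:
  fixes p u v :: real
  assumes "1 \<le> p" "0 \<le> u" "0 \<le> v"
  shows "(u + v) powr p \<le> 2 powr (p - 1) * (u powr p + v powr p)"
proof -
  have "(u + v) powr p = 2 powr p * (1 / 2 * u + (1 - 1 / 2) * v) powr p"
    using assms by (subst powr_mult[symmetric]) (auto simp: algebra_simps)
  also have "\<dots> \<le> 2 powr p * (1 / 2 * u powr p + (1 - 1 / 2) * v powr p)"
    using assms by (intro mult_left_mono powr_convex_combination) auto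
  also have "\<dots> = 2 powr (p - 1) * (u powr p + v powr p)"
    by (simp add: powr_diff field_simps)
  finally show ?thesis .
qed

text \<open>Bounds \<open>A\<close> and \<open>B\<close> replace the norms, so no roots of extended
  values occur. Convexity is applied to \<open>f x / A\<close> and \<open>g x / B\<close> with
  weights \<open>A / (A + B)\<close> and \<open>B / (A + B)\<close>, for which the combination is
  \<open>(f x + g x) / (A + B)\<close>. After clearing denominators the coefficients
  \<open>c\<close> and \<open>d\<close> satisfy
  \<open>c * A powr p + d * B powr p = (A + B) powr p\<close>.\<close>

lemma nn_integral_minkowski:
  fixes f g :: "'a \<Rightarrow> real"
  assumes p: "1 \<le> p" and "0 < A" "0 < B"
    and [measurable]: "f \<in> borel_measurable M" "g \<in> borel_measurable M"
    and nonneg: "\<And>x. 0 \<le> f x" "\<And>x. 0 \<le> g x"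
    and f: "(\<integral>\<^sup>+x. ennreal (f x powr p) \<partial>M) \<le> ennreal (A powr p)"
    and g: "(\<integral>\<^sup>+x. ennreal (g x powr p) \<partial>M) \<le> ennreal (B powr p)"
  shows "(\<integral>\<^sup>+x. ennreal ((f x + g x) powr p) \<partial>M) \<le> ennreal ((A + B) powr p)"
proof -
  define t where "t = A / (A + B)"
  have t: "0 \<le> t" "t \<le> 1" "1 - t = B / (A + B)"
    using assms by (auto simp: t_def field_simps)
  define c d where "c = (A + B) powr p * t / A powr p"
    and "d = (A + B) powr p * (1 - t) / B powr p"
  have cd: "0 \<le> c" "0 \<le> d" using t(1,2) by (simp_all only: c_def d_def) auto
  have pointwise: "(f x + g x) powr p \<le> c * f x powr p + d * g x powr p" for x
  proof -
    have "t * (f x / A) + (1 - t) * (g x / B) = (f x + g x) / (A + B)"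
      using assms by (simp only: t) (simp add: t_def add_divide_distrib)
    then have "((f x + g x) / (A + B)) powr p \<le>
        t * (f x / A) powr p + (1 - t) * (g x / B) powr p"
      using powr_convex_combination[OF p t(1,2), of "f x / A" "g x / B"] nonneg[of x] assms
      by simp
    then have "(A + B) powr p * ((f x + g x) / (A + B)) powr p \<le>
        (A + B) powr p * (t * (f x / A) powr p + (1 - t) * (g x / B) powr p)"
      by (intro mult_left_mono) auto
    then show ?thesis
      using nonneg[of x] assms by (simp add: powr_divide c_def d_def field_simps)
  qed
  have "(\<integral>\<^sup>+x. ennreal ((f x + g x) powr p) \<partial>M) \<le>
      (\<integral>\<^sup>+x. ennreal c * ennreal (f x powr p) + ennreal d * ennreal (g x powr p) \<partial>M)"
    using pointwise cd
    by (intro nn_integral_mono) (simp flip: ennreal_mult ennreal_plus add: ennreal_leI)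
  also have "\<dots> = ennreal c * (\<integral>\<^sup>+x. ennreal (f x powr p) \<partial>M) +
      ennreal d * (\<integral>\<^sup>+x. ennreal (g x powr p) \<partial>M)"
    by (subst nn_integral_add) (auto simp: nn_integral_cmult)
  also have "\<dots> \<le> ennreal c * ennreal (A powr p) + ennreal d * ennreal (B powr p)"
    by (intro add_mono mult_left_mono f g) auto
  also have "\<dots> = ennreal (c * A powr p + d * B powr p)"
    using cd by (simp add: ennreal_mult)
  also have "c * A powr p + d * B powr p = (A + B) powr p"
    using assms by (simp add: c_def d_def) (simp add: algebra_simps)
  finally show ?thesis .
qed

section \<open>Couplings prescribed on countably many cells\<close>

lemma nn_integral_nat_valued:
  fixes u :: "nat \<Rightarrow> ennreal"
  assumes [measurable]: "\<kappa> \<in> B \<rightarrow>\<^sub>M count_space UNIV"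
  shows "(\<integral>\<^sup>+y. u (\<kappa> y) \<partial>B) = (\<Sum>l. u l * emeasure B (\<kappa> -` {l} \<inter> space B))"
proof -
  have "(\<integral>\<^sup>+y. u (\<kappa> y) \<partial>B) = (\<integral>\<^sup>+y. (\<Sum>l. u l * indicator (\<kappa> -` {l} \<inter> space B) y) \<partial>B)"
  proof (rule nn_integral_cong)
    fix y assume "y \<in> space B"
    then have "(\<Sum>l. u l * indicator (\<kappa> -` {l} \<inter> space B) y) =
        (\<Sum>l. if l = \<kappa> y then u l else (0::ennreal))"
      by (intro suminf_cong) (auto simp: indicator_def)
    also have "\<dots> = u (\<kappa> y)"
      using suminf_finite[of "{\<kappa> y}" "\<lambda>l. if l = \<kappa> y then u l else (0::ennreal)"] by simp
    finally show "u (\<kappa> y) = (\<Sum>l. u l * indicator (\<kappa> -` {l} \<inter> space B) y)" by simp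
  qed
  also have "\<dots> = (\<Sum>l. u l * emeasure B (\<kappa> -` {l} \<inter> space B))"
  proof -
    have [measurable]: "\<kappa> -` {l} \<inter> space B \<in> sets B" for l
      by (intro measurable_sets[OF assms]) auto
    show ?thesis by (simp add: nn_integral_suminf nn_integral_cmult_indicator)
  qed
  finally show ?thesis .
qed

text \<open>The cancellation has to survive cells of mass zero: for \<open>b = 0\<close> the last
  hypothesis forces \<open>j = 0\<close>, and both sides are zero.\<close>

lemma ennreal_div_mult_cancel:
  fixes j a b :: ennreal
  assumes "a \<noteq> \<top>" "b \<noteq> \<top>" "b = 0 \<Longrightarrow> j = 0"
  shows "j / (a * b) * b = j / a"
proof (cases "b = 0")
  case False
  have "inverse (a * b) = inverse a * inverse b"
    using assms by (simp add: ennreal_inverse_mult less_top)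
  then have "j / (a * b) * b = j * (b / b) / a"
    by (simp add: divide_ennreal_def mult_ac)
  then show ?thesis using assms False by (simp add: less_top)
qed (use assms in simp)

text \<open>The substitute for disintegration: a coupling \<open>J\<close> of the laws of two
  discrete labels lifts to the underlying measures by an explicit density. With a diagonal
  \<open>J\<close> it glues couplings; with a maximal coupling as \<open>J\<close> it compares
  measures whose cells have similar masses.\<close>

lemma coupling_along_nat_valued_maps:
  assumes A: "prob_space A" and B: "prob_space B"
    and \<alpha>[measurable]: "\<alpha> \<in> A \<rightarrow>\<^sub>M count_space (UNIV :: nat set)"
    and \<beta>[measurable]: "\<beta> \<in> B \<rightarrow>\<^sub>M count_space (UNIV :: nat set)"
    and row: "\<And>k. (\<Sum>l. J k l) = emeasure A (\<alpha> -` {k} \<inter> space A)"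
    and col: "\<And>l. (\<Sum>k. J k l) = emeasure B (\<beta> -` {l} \<inter> space B)"
  obtains G where "sets G = sets (A \<Otimes>\<^sub>M B)" "distr G A fst = A" "distr G B snd = B"
    "\<And>u :: nat \<Rightarrow> nat \<Rightarrow> ennreal.
      (\<integral>\<^sup>+xy. u (\<alpha> (fst xy)) (\<beta> (snd xy)) \<partial>G) = (\<Sum>k. \<Sum>l. u k l * J k l)"
proof -
  interpret A: prob_space A by fact
  interpret B: prob_space B by fact
  interpret pair_sigma_finite A B ..
  define a where "a k = emeasure A (\<alpha> -` {k} \<inter> space A)" for k
  define b where "b l = emeasure B (\<beta> -` {l} \<inter> space B)" for l
  have fin: "a k \<noteq> \<top>" "b l \<noteq> \<top>" for k l by (auto simp: a_def b_def)
  have J_le: "J k l \<le> a k" "J k l \<le> b l" for k l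
    using sum_le_suminf[of "\<lambda>l. J k l" "{l}"] sum_le_suminf[of "\<lambda>k. J k l" "{k}"]
    by (auto simp: a_def b_def row col)
  then have J_zero: "a k = 0 \<Longrightarrow> J k l = 0" "b l = 0 \<Longrightarrow> J k l = 0" for k l
    by (metis le_zero_eq)+
  \<comment> \<open>Given the cells, the two points are drawn independently from the conditional laws of \<open>A\<close> and \<open>B\<close>.\<close>
  define w where "w k l = J k l / (a k * b l)" for k l
  have w_row: "w k l * b l = J k l / a k" for k l
    unfolding w_def by (intro ennreal_div_mult_cancel fin J_zero)
  have w_col: "w k l * a k = J k l / b l" for k l
    unfolding w_def by (subst mult.commute[of "a k"], intro ennreal_div_mult_cancel fin J_zero)
  define G where "G = density (A \<Otimes>\<^sub>M B) (\<lambda>xy. w (\<alpha> (fst xy)) (\<beta> (snd xy)))"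
  have [measurable]: "(\<lambda>xy. u (\<alpha> (fst xy)) (\<beta> (snd xy))) \<in> borel_measurable (A \<Otimes>\<^sub>M B)"
    for u :: "nat \<Rightarrow> nat \<Rightarrow> ennreal"
    by measurable
  \<comment> \<open>On a cell of mass zero the density integrates to 0 instead of 1, so such cells
    must be discarded before the marginals are computed.\<close>
  have AE_a: "AE x in A. a (\<alpha> x) \<noteq> 0"
  proof -
    have "(\<integral>\<^sup>+x. (if a (\<alpha> x) = 0 then 1 else 0) \<partial>A) =
        (\<Sum>k. (if a k = 0 then 1 else 0) * a k)"
      unfolding a_def by (rule nn_integral_nat_valued) fact
    also have "(\<lambda>k. (if a k = 0 then 1 else 0) * a k) = (\<lambda>_. 0)" by auto
    finally show ?thesis
      by (simp add: nn_integral_0_iff_AE split: if_splits)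
  qed
  have AE_b: "AE y in B. b (\<beta> y) \<noteq> 0"
  proof -
    have "(\<integral>\<^sup>+y. (if b (\<beta> y) = 0 then 1 else 0) \<partial>B) =
        (\<Sum>k. (if b k = 0 then 1 else 0) * b k)"
      unfolding b_def by (rule nn_integral_nat_valued) fact
    also have "(\<lambda>k. (if b k = 0 then 1 else 0) * b k) = (\<lambda>_. 0)" by auto
    finally show ?thesis
      by (simp add: nn_integral_0_iff_AE split: if_splits)
  qed
  have sets_G: "sets G = sets (A \<Otimes>\<^sub>M B)" by (simp add: G_def)
  have fst_G: "fst \<in> G \<rightarrow>\<^sub>M A" and snd_G: "snd \<in> G \<rightarrow>\<^sub>M B"
    by (auto simp: G_def)
  have "emeasure (distr G A fst) E = emeasure A E" if E[measurable]: "E \<in> sets A" for E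
  proof -
    have "emeasure (distr G A fst) E = (\<integral>\<^sup>+xy. indicator E (fst xy) \<partial>G)"
      by (subst nn_integral_distr[OF fst_G, symmetric]) auto
    also have "\<dots> =
        (\<integral>\<^sup>+xy. w (\<alpha> (fst xy)) (\<beta> (snd xy)) * indicator E (fst xy) \<partial>(A \<Otimes>\<^sub>M B))"
      unfolding G_def by (subst nn_integral_density) auto
    also have "\<dots> = (\<integral>\<^sup>+x. \<integral>\<^sup>+y. w (\<alpha> x) (\<beta> y) * indicator E x \<partial>B \<partial>A)"
      by (subst B.nn_integral_fst[symmetric]) auto
    also have "\<dots> = (\<integral>\<^sup>+x. indicator E x \<partial>A)"
    proof (intro nn_integral_cong_AE, use AE_a in eventually_elim)
      fix x assume x: "a (\<alpha> x) \<noteq> 0"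
      have "(\<integral>\<^sup>+y. w (\<alpha> x) (\<beta> y) * indicator E x \<partial>B) =
          (\<integral>\<^sup>+y. w (\<alpha> x) (\<beta> y) \<partial>B) * indicator E x"
        by (intro nn_integral_multc) measurable
      also have "(\<integral>\<^sup>+y. w (\<alpha> x) (\<beta> y) \<partial>B) = (\<Sum>l. w (\<alpha> x) l * b l)"
        unfolding b_def by (rule nn_integral_nat_valued) fact
      also have "\<dots> = (\<Sum>l. J (\<alpha> x) l) / a (\<alpha> x)"
        by (simp add: w_row divide_ennreal_def)
      also have "\<dots> = 1"
        using x fin by (simp add: row less_top flip: a_def)
      finally show "(\<integral>\<^sup>+y. w (\<alpha> x) (\<beta> y) * indicator E x \<partial>B) = indicator E x" by simp
    qed
    finally show ?thesis by simp
  qed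
  then have marginal_A: "distr G A fst = A" by (intro measure_eqI) auto
  have "emeasure (distr G B snd) E = emeasure B E" if E[measurable]: "E \<in> sets B" for E
  proof -
    have "emeasure (distr G B snd) E = (\<integral>\<^sup>+xy. indicator E (snd xy) \<partial>G)"
      by (subst nn_integral_distr[OF snd_G, symmetric]) auto
    also have "\<dots> =
        (\<integral>\<^sup>+xy. w (\<alpha> (fst xy)) (\<beta> (snd xy)) * indicator E (snd xy) \<partial>(A \<Otimes>\<^sub>M B))"
      unfolding G_def by (subst nn_integral_density) auto
    also have "\<dots> = (\<integral>\<^sup>+y. \<integral>\<^sup>+x. w (\<alpha> x) (\<beta> y) * indicator E y \<partial>A \<partial>B)"
      by (subst nn_integral_snd[symmetric]) (auto simp: split_beta')
    also have "\<dots> = (\<integral>\<^sup>+y. indicator E y \<partial>B)"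
    proof (intro nn_integral_cong_AE, use AE_b in eventually_elim)
      fix y assume y: "b (\<beta> y) \<noteq> 0"
      have "(\<integral>\<^sup>+x. w (\<alpha> x) (\<beta> y) * indicator E y \<partial>A) =
          (\<integral>\<^sup>+x. w (\<alpha> x) (\<beta> y) \<partial>A) * indicator E y"
        by (intro nn_integral_multc) measurable
      also have "(\<integral>\<^sup>+x. w (\<alpha> x) (\<beta> y) \<partial>A) = (\<Sum>k. w k (\<beta> y) * a k)"
        unfolding a_def by (rule nn_integral_nat_valued) fact
      also have "\<dots> = (\<Sum>k. J k (\<beta> y)) / b (\<beta> y)"
        by (simp add: w_col divide_ennreal_def)
      also have "\<dots> = 1"
        using y fin by (simp add: col less_top flip: b_def)
      finally show "(\<integral>\<^sup>+x. w (\<alpha> x) (\<beta> y) * indicator E y \<partial>A) = indicator E y" by simp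
    qed
    finally show ?thesis by simp
  qed
  then have marginal_B: "distr G B snd = B" by (intro measure_eqI) auto
  have "(\<integral>\<^sup>+xy. u (\<alpha> (fst xy)) (\<beta> (snd xy)) \<partial>G) = (\<Sum>k. \<Sum>l. u k l * J k l)"
    for u :: "nat \<Rightarrow> nat \<Rightarrow> ennreal"
  proof -
    have "(\<integral>\<^sup>+xy. u (\<alpha> (fst xy)) (\<beta> (snd xy)) \<partial>G) =
        (\<integral>\<^sup>+x. \<integral>\<^sup>+y. w (\<alpha> x) (\<beta> y) * u (\<alpha> x) (\<beta> y) \<partial>B \<partial>A)"
      unfolding G_def
      by (subst nn_integral_density, measurable, subst B.nn_integral_fst[symmetric]) auto
    also have "\<dots> = (\<integral>\<^sup>+x. (\<Sum>l. w (\<alpha> x) l * u (\<alpha> x) l * b l) \<partial>A)"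
      unfolding b_def by (intro nn_integral_cong nn_integral_nat_valued \<beta>)
    also have "\<dots> = (\<Sum>k. (\<Sum>l. w k l * u k l * b l) * a k)"
      unfolding a_def by (rule nn_integral_nat_valued) fact
    also have "\<dots> = (\<Sum>k. \<Sum>l. u k l * J k l)"
    proof (intro suminf_cong)
      fix k
      have "w k l * u k l * b l * a k = u k l * J k l" for l
      proof -
        have "w k l * u k l * b l * a k = u k l * (w k l * b l * a k)" by (simp add: mult_ac)
        also have "w k l * b l * a k = J k l"
          using J_zero(1)[of k l] fin(1)[of k]
          by (cases "a k = 0") (auto simp: w_row ennreal_divide_times less_top)
        finally show ?thesis .
      qed
      then show "(\<Sum>l. w k l * u k l * b l) * a k = (\<Sum>l. u k l * J k l)"
        by (simp flip: ennreal_suminf_multc)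
    qed
    finally show ?thesis .
  qed
  then show thesis using sets_G marginal_A marginal_B by (rule that[rotated 3])
qed

section \<open>Costs of couplings and the infimum\<close>

definition transport_cost :: "real \<Rightarrow> ('a::euclidean_space \<times> 'a) measure \<Rightarrow> ennreal" where
  "transport_cost p \<gamma> = (\<integral>\<^sup>+xy. ennreal (norm (fst xy - snd xy) powr p) \<partial>\<gamma>)"

text \<open>
  Upper bounds on the distance in terms of extended-valued costs: no moment assumption is needed to
  make sense of them.
\<close>

definition wasserstein_le ::
    "real \<Rightarrow> 'a::euclidean_space measure \<Rightarrow> 'a measure \<Rightarrow> real \<Rightarrow> bool" where
  "wasserstein_le p \<mu> \<nu> r \<longleftrightarrow>
     (\<forall>s>r. \<exists>\<gamma>\<in>couplings \<mu> \<nu>. transport_cost p \<gamma> \<le> ennreal (s powr p))"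

lemma sets_pair_borel:
  fixes \<mu> :: "'a::second_countable_topology measure" and \<nu> :: "'b::second_countable_topology measure"
  assumes "sets \<mu> = sets borel" "sets \<nu> = sets borel"
  shows "sets (\<mu> \<Otimes>\<^sub>M \<nu>) = sets borel"
  using sets_pair_measure_cong[OF assms] by (simp only: borel_prod)

lemma distr_pair_marginals:
  assumes "prob_space A" "prob_space B"
  shows "distr (A \<Otimes>\<^sub>M B) A fst = A" "distr (A \<Otimes>\<^sub>M B) B snd = B"
proof -
  interpret A: prob_space A by fact
  interpret B: prob_space B by fact
  have "(fst -` E \<inter> space (A \<Otimes>\<^sub>M B)) = E \<times> space B" if "E \<in> sets A" for E
    using sets.sets_into_space[OF that] by (auto simp: space_pair_measure)
  then show "distr (A \<Otimes>\<^sub>M B) A fst = A"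
    by (intro measure_eqI) (auto simp: emeasure_distr B.emeasure_pair_measure_Times B.emeasure_space_1)
  have "(snd -` E \<inter> space (A \<Otimes>\<^sub>M B)) = space A \<times> E" if "E \<in> sets B" for E
    using sets.sets_into_space[OF that] by (auto simp: space_pair_measure)
  then show "distr (A \<Otimes>\<^sub>M B) B snd = B"
    by (intro measure_eqI) (auto simp: emeasure_distr B.emeasure_pair_measure_Times A.emeasure_space_1)
qed

lemma product_in_couplings:
  assumes "sets \<mu> = sets borel" "prob_space \<mu>" "sets \<nu> = sets borel" "prob_space \<nu>"
  shows "\<mu> \<Otimes>\<^sub>M \<nu> \<in> couplings \<mu> \<nu>"
proof -
  interpret pair_prob_space \<mu> \<nu>
    using assms by (simp add: pair_prob_space_def pair_sigma_finite_def prob_space_imp_sigma_finite)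
  have "distr (\<mu> \<Otimes>\<^sub>M \<nu>) borel fst = distr (\<mu> \<Otimes>\<^sub>M \<nu>) \<mu> fst"
    "distr (\<mu> \<Otimes>\<^sub>M \<nu>) borel snd = distr (\<mu> \<Otimes>\<^sub>M \<nu>) \<nu> snd"
    by (intro distr_cong; simp add: assms)+
  then show ?thesis
    using assms by (simp add: couplings_def sets_pair_borel distr_pair_marginals prob_space_axioms)
qed

lemma couplingsD:
  assumes "\<gamma> \<in> couplings \<mu> \<nu>"
  shows "sets \<gamma> = sets borel" "prob_space \<gamma>" "distr \<gamma> borel fst = \<mu>" "distr \<gamma> borel snd = \<nu>"
    "sets \<mu> = sets borel" "sets \<nu> = sets borel"
  using assms by (auto simp: couplings_def)

lemma measurable_pair_borel:
  assumes "sets \<gamma> = sets borel"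
  shows "fst \<in> \<gamma> \<rightarrow>\<^sub>M (borel :: 'a::second_countable_topology measure)"
    "snd \<in> \<gamma> \<rightarrow>\<^sub>M (borel :: 'b::second_countable_topology measure)"
  unfolding measurable_cong_sets[OF assms refl]
  by (simp_all flip: borel_prod)

text \<open>A nonintegrable cost would have Bochner integral 0. Finite moments exclude this, so that
  \<open>wasserstein\<close> ranges over genuine costs.\<close>

lemma transport_cost_integrable:
  assumes p: "1 \<le> p"
    and \<mu>: "\<mu> \<in> finite_moment_measures p" and \<nu>: "\<nu> \<in> finite_moment_measures p"
    and \<gamma>: "\<gamma> \<in> couplings \<mu> \<nu>"
  shows "integrable \<gamma> (\<lambda>xy. norm (fst xy - snd xy) powr p)"
proof -
  note [measurable] = measurable_pair_borel[OF couplingsD(1)[OF \<gamma>]]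
  have "integrable (distr \<gamma> borel fst) (\<lambda>x. norm x powr p)"
    "integrable (distr \<gamma> borel snd) (\<lambda>x. norm x powr p)"
    using \<mu> \<nu> couplingsD[OF \<gamma>] by (simp_all add: finite_moment_measures_def)
  then have "integrable \<gamma> (\<lambda>xy. norm (fst xy) powr p)" "integrable \<gamma> (\<lambda>xy. norm (snd xy) powr p)"
    by (simp_all add: integrable_distr_eq)
  then have "integrable \<gamma> (\<lambda>xy. 2 powr (p - 1) * (norm (fst xy) powr p + norm (snd xy) powr p))"
    by simp
  then show ?thesis
  proof (rule Bochner_Integration.integrable_bound)
    show "AE xy in \<gamma>. norm (norm (fst xy - snd xy) powr p) \<le>
        norm (2 powr (p - 1) * (norm (fst xy) powr p + norm (snd xy) powr p))"
    proof (rule AE_I2)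
      fix xy :: "'a \<times> 'a"
      have "norm (fst xy - snd xy) powr p \<le> (norm (fst xy) + norm (snd xy)) powr p"
        using p by (intro powr_mono2 norm_triangle_ineq4) auto
      also have "\<dots> \<le> 2 powr (p - 1) * (norm (fst xy) powr p + norm (snd xy) powr p)"
        using p by (intro powr_add_le) auto
      finally show "norm (norm (fst xy - snd xy) powr p) \<le>
          norm (2 powr (p - 1) * (norm (fst xy) powr p + norm (snd xy) powr p))" by simp
    qed
  qed measurable
qed

text \<open>Quantifying over all \<open>s > r\<close> reproduces the infimum whether or not it is
  attained. Nonnegativity of \<open>r\<close> keeps every such \<open>s\<close> positive, where
  \<open>powr\<close> is monotone and can be inverted.\<close>

lemma wasserstein_le_iff:
  assumes p: "1 \<le> p" and r: "0 \<le> r"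
    and \<mu>: "\<mu> \<in> finite_moment_measures p" and \<nu>: "\<nu> \<in> finite_moment_measures p"
  shows "wasserstein p \<mu> \<nu> \<le> r \<longleftrightarrow> wasserstein_le p \<mu> \<nu> r"
proof -
  define c where
    "c \<gamma> = (\<integral>xy. norm (fst xy - snd xy) powr p \<partial>\<gamma>) powr (1 / p)" for \<gamma> :: "('a \<times> 'a) measure"
  have ne: "couplings \<mu> \<nu> \<noteq> {}"
    using product_in_couplings[of \<mu> \<nu>] \<mu> \<nu> by (auto simp: finite_moment_measures_def)
  have bdd: "bdd_below (c ` couplings \<mu> \<nu>)"
    by (intro bdd_belowI[of _ 0]) (auto simp: c_def)
  have cost: "transport_cost p \<gamma> \<le> ennreal (s powr p) \<longleftrightarrow> c \<gamma> \<le> s"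
    if "\<gamma> \<in> couplings \<mu> \<nu>" "0 \<le> s" for \<gamma> s
  proof -
    define I where "I = (\<integral>xy. norm (fst xy - snd xy) powr p \<partial>\<gamma>)"
    have I: "0 \<le> I" by (auto simp: I_def)
    have "transport_cost p \<gamma> = ennreal I"
      unfolding transport_cost_def I_def
      by (intro nn_integral_eq_integral transport_cost_integrable[OF p \<mu> \<nu> that(1)]) auto
    moreover have "I \<le> s powr p \<longleftrightarrow> I powr (1 / p) \<le> s"
    proof
      assume "I \<le> s powr p"
      then have "I powr (1 / p) \<le> (s powr p) powr (1 / p)" using p I by (intro powr_mono2) auto
      then show "I powr (1 / p) \<le> s" using p that by (simp add: powr_powr)
    next
      assume "I powr (1 / p) \<le> s"
      then have "(I powr (1 / p)) powr p \<le> s powr p" using p I by (intro powr_mono2) auto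
      then show "I \<le> s powr p" using p I by (simp add: powr_powr)
    qed
    ultimately show ?thesis using I by (simp add: c_def I_def)
  qed
  show ?thesis
  proof
    assume le: "wasserstein p \<mu> \<nu> \<le> r"
    show "wasserstein_le p \<mu> \<nu> r"
      unfolding wasserstein_le_def
    proof (intro allI impI)
      fix s assume s: "r < s"
      then have "(INF \<gamma>\<in>couplings \<mu> \<nu>. c \<gamma>) < s" using le by (simp add: wasserstein_def c_def)
      then obtain \<gamma> where "\<gamma> \<in> couplings \<mu> \<nu>" "c \<gamma> < s" using ne bdd by (auto simp: cINF_less_iff)
      then show "\<exists>\<gamma>\<in>couplings \<mu> \<nu>. transport_cost p \<gamma> \<le> ennreal (s powr p)"
        using cost[of \<gamma> s] s r by auto
    qed
  next
    assume le: "wasserstein_le p \<mu> \<nu> r"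
    show "wasserstein p \<mu> \<nu> \<le> r"
    proof (rule dense_ge)
      fix s assume s: "r < s"
      then obtain \<gamma> where \<gamma>: "\<gamma> \<in> couplings \<mu> \<nu>" "c \<gamma> \<le> s"
        using le cost r unfolding wasserstein_le_def by fastforce
      then have "(INF \<gamma>\<in>couplings \<mu> \<nu>. c \<gamma>) \<le> s" using bdd by (meson cINF_lower order_trans)
      then show "wasserstein p \<mu> \<nu> \<le> s" by (simp add: wasserstein_def c_def)
    qed
  qed
qed

lemma wasserstein_le_commute:
  assumes "wasserstein_le p \<mu> \<nu> r"
  shows "wasserstein_le p \<nu> \<mu> r"
  unfolding wasserstein_le_def
proof (intro allI impI)
  fix s assume "r < s"
  then obtain \<gamma> where \<gamma>: "\<gamma> \<in> couplings \<mu> \<nu>" "transport_cost p \<gamma> \<le> ennreal (s powr p)"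
    using assms by (auto simp: wasserstein_le_def)
  note D = couplingsD[OF \<gamma>(1)]
  interpret prob_space \<gamma> by fact
  note [measurable] = measurable_pair_borel[OF D(1)]
  have swap[measurable]: "(\<lambda>xy. (snd xy, fst xy)) \<in> \<gamma> \<rightarrow>\<^sub>M borel" by (simp flip: borel_prod)
  define \<gamma>' where "\<gamma>' = distr \<gamma> borel (\<lambda>xy. (snd xy, fst xy))"
  note [measurable] = measurable_pair_borel[of borel, OF refl]
  have "\<gamma>' \<in> couplings \<nu> \<mu>"
    using D by (auto simp: couplings_def \<gamma>'_def prob_space_distr distr_distr comp_def)
  moreover have "transport_cost p \<gamma>' = transport_cost p \<gamma>"
    by (simp add: transport_cost_def \<gamma>'_def nn_integral_distr norm_minus_commute)
  ultimately show "\<exists>\<gamma>\<in>couplings \<nu> \<mu>. transport_cost p \<gamma> \<le> ennreal (s powr p)"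
    using \<gamma>(2) by metis
qed

section \<open>Small cells and gluing\<close>

text \<open>The label of a point is the first index at which an enumeration of a countable dense set
  comes within \<open>\<delta> / 2\<close>. Equal labels mean a common centre, and taking the least
  index makes the label measurable.\<close>

lemma exists_small_cells:
  fixes \<delta> :: real
  assumes "0 < \<delta>"
  obtains \<kappa> :: "'a::euclidean_space \<Rightarrow> nat"
  where "\<kappa> \<in> borel \<rightarrow>\<^sub>M count_space UNIV" "\<And>x y. \<kappa> x = \<kappa> y \<Longrightarrow> dist x y \<le> \<delta>"
proof -
  obtain D :: "'a set" where D: "countable D" "\<And>X. open X \<Longrightarrow> X \<noteq> {} \<Longrightarrow> \<exists>d\<in>D. d \<in> X"
    using countable_dense_exists by blast
  then have "D \<noteq> {}" using open_UNIV by blast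
  define \<kappa> where "\<kappa> x = (LEAST n. dist x (from_nat_into D n) < \<delta> / 2)" for x
  have [measurable]: "\<kappa> \<in> borel \<rightarrow>\<^sub>M count_space UNIV"
    unfolding \<kappa>_def by measurable
  have near: "dist x (from_nat_into D (\<kappa> x)) < \<delta> / 2" for x
  proof -
    obtain d where "d \<in> D" "d \<in> ball x (\<delta> / 2)"
      using D(2)[of "ball x (\<delta> / 2)"] assms by auto
    then have "dist x (from_nat_into D (to_nat_on D d)) < \<delta> / 2" using D(1) by simp
    then show ?thesis unfolding \<kappa>_def by (rule LeastI)
  qed
  have "dist x y \<le> \<delta>" if "\<kappa> x = \<kappa> y" for x y
    using near[of x] near[of y] that dist_triangle2[of x y "from_nat_into D (\<kappa> x)"] by simp
  then show thesis using that[of \<kappa>] by simp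
qed

lemma measurable_nat_pair:
  fixes u :: "nat \<Rightarrow> nat \<Rightarrow> ennreal"
  assumes [measurable]: "f \<in> M \<rightarrow>\<^sub>M count_space UNIV" "g \<in> M \<rightarrow>\<^sub>M count_space UNIV"
  shows "(\<lambda>x. u (f x) (g x)) \<in> borel_measurable M"
  by measurable

text \<open>The two copies of the middle point need not coincide, it is enough that they share a
  cell. Joining \<open>\<gamma>\<close> and \<open>\<gamma>'\<close> independently given the cell
  achieves this, and the jump between the copies costs at most \<open>\<delta>\<close>.\<close>

lemma gluing_estimate:
  fixes \<mu> \<nu> \<rho> :: "'a::euclidean_space measure"
  assumes p: "1 \<le> p" and pos: "0 < r" "0 < s" "0 < \<delta>"
    and \<gamma>: "\<gamma> \<in> couplings \<mu> \<nu>" "transport_cost p \<gamma> \<le> ennreal (r powr p)"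
    and \<gamma>': "\<gamma>' \<in> couplings \<nu> \<rho>" "transport_cost p \<gamma>' \<le> ennreal (s powr p)"
  shows "\<exists>\<Gamma>\<in>couplings \<mu> \<rho>. transport_cost p \<Gamma> \<le> ennreal ((r + \<delta> + s) powr p)"
proof -
  note D = couplingsD[OF \<gamma>(1)] and D' = couplingsD[OF \<gamma>'(1)]
  note [measurable] = measurable_pair_borel[OF D(1)] measurable_pair_borel[OF D'(1)]
    measurable_pair_borel[of borel, OF refl]
  interpret \<gamma>: prob_space \<gamma> by fact
  interpret \<gamma>': prob_space \<gamma>' by fact
  obtain \<kappa> :: "'a \<Rightarrow> nat" where \<kappa>[measurable]: "\<kappa> \<in> borel \<rightarrow>\<^sub>M count_space UNIV"
    and cells: "\<And>x y. \<kappa> x = \<kappa> y \<Longrightarrow> dist x y \<le> \<delta>"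
    using exists_small_cells[OF pos(3)] by metis
  define m where "m k = emeasure \<nu> (\<kappa> -` {k})" for k
  have [measurable]: "\<kappa> -` {k} \<in> sets borel" for k
    using measurable_sets[OF \<kappa>, of "{k}"] by simp
  have "m k = emeasure (distr \<gamma> borel snd) (\<kappa> -` {k})"
    "m k = emeasure (distr \<gamma>' borel fst) (\<kappa> -` {k})" for k
    by (simp_all only: m_def D(4) D'(3))
  then have m: "m k = emeasure \<gamma> ((\<lambda>xy. \<kappa> (snd xy)) -` {k} \<inter> space \<gamma>)"
    "m k = emeasure \<gamma>' ((\<lambda>xy. \<kappa> (fst xy)) -` {k} \<inter> space \<gamma>')" for k
    by (simp_all add: emeasure_distr vimage_def)
  \<comment> \<open>The diagonal forces the two labels to agree. It has the right row and column
    sums because \<open>\<nu>\<close> is a marginal of both couplings, which makes the label masses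
    equal.\<close>
  define J where "J = (\<lambda>k l. if k = l then m k else 0)"
  have row: "(\<Sum>l. J k l) = m k" for k
    using suminf_finite[of "{k}" "J k"] by (simp add: J_def)
  have col: "(\<Sum>k. J k l) = m l" for l
    using suminf_finite[of "{l}" "\<lambda>k. J k l"] by (simp add: J_def)
  obtain G where G: "sets G = sets (\<gamma> \<Otimes>\<^sub>M \<gamma>')" "distr G \<gamma> fst = \<gamma>" "distr G \<gamma>' snd = \<gamma>'"
    and law: "\<And>u. (\<integral>\<^sup>+w. u (\<kappa> (snd (fst w))) (\<kappa> (fst (snd w))) \<partial>G) = (\<Sum>k. \<Sum>l. u k l * J k l)"
    by (rule coupling_along_nat_valued_maps[of \<gamma> \<gamma>' "\<lambda>xy. \<kappa> (snd xy)" "\<lambda>xy. \<kappa> (fst xy)" J])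
      (auto simp: row col m(1)[symmetric] m(2)[symmetric] D D')
  have G_meas[measurable]: "fst \<in> G \<rightarrow>\<^sub>M \<gamma>" "snd \<in> G \<rightarrow>\<^sub>M \<gamma>'"
    by (simp_all add: measurable_cong_sets[OF G(1) refl])
  interpret G: prob_space G
    using D(2) prob_space_distrD[of fst G \<gamma>] by (simp add: G)
  have G_cells: "(\<lambda>w. if \<kappa> (snd (fst w)) = \<kappa> (fst (snd w)) then 0 else 1 :: ennreal) \<in> borel_measurable G"
    by (rule measurable_nat_pair[where u = "\<lambda>k l. if k = l then 0 else 1"])
      (intro measurable_compose[OF _ \<kappa>], measurable)+
  have same_cell: "AE w in G. \<kappa> (snd (fst w)) = \<kappa> (fst (snd w))"
  proof -
    have "(\<lambda>k. \<Sum>l. (if k = l then 0 else 1) * J k l) = (\<lambda>_. 0)"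
      by (auto simp: J_def fun_eq_iff if_distrib cong: if_cong)
    then have "(\<integral>\<^sup>+w. (if \<kappa> (snd (fst w)) = \<kappa> (fst (snd w)) then 0 else 1) \<partial>G) = 0"
      using law[of "\<lambda>k l. if k = l then 0 else 1"] by simp
    then have "AE w in G. (if \<kappa> (snd (fst w)) = \<kappa> (fst (snd w)) then 0 else 1 :: ennreal) = 0"
      using G_cells by (subst (asm) nn_integral_0_iff_AE) auto
    then show ?thesis by eventually_elim (simp split: if_splits)
  qed
  define \<Gamma> where "\<Gamma> = distr G borel (\<lambda>w. (fst (fst w), snd (snd w)))"
  have [measurable]: "(\<lambda>w. (fst (fst w), snd (snd w))) \<in> G \<rightarrow>\<^sub>M borel"
    by (simp flip: borel_prod)
  have "distr G borel (\<lambda>w. fst (fst w)) = distr (distr G \<gamma> fst) borel fst"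
    "distr G borel (\<lambda>w. snd (snd w)) = distr (distr G \<gamma>' snd) borel snd"
    by (simp_all add: distr_distr comp_def)
  then have "\<Gamma> \<in> couplings \<mu> \<rho>"
    using D D' by (auto simp: couplings_def \<Gamma>_def G.prob_space_distr distr_distr comp_def G)
  moreover have "transport_cost p \<Gamma> \<le> ennreal ((r + \<delta> + s) powr p)"
  proof -
    define f g where "f w = norm (fst (fst w) - snd (fst w))"
      and "g w = norm (fst (snd w) - snd (snd w))" for w :: "('a \<times> 'a) \<times> 'a \<times> 'a"
    have [measurable]: "f \<in> borel_measurable G" "g \<in> borel_measurable G"
      unfolding f_def[abs_def] g_def[abs_def] by measurable
    have f: "(\<integral>\<^sup>+w. ennreal (f w powr p) \<partial>G) \<le> ennreal (r powr p)"
    proof -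
      have "(\<integral>\<^sup>+w. ennreal (f w powr p) \<partial>G) = transport_cost p (distr G \<gamma> fst)"
        by (simp add: transport_cost_def nn_integral_distr f_def)
      then show ?thesis using \<gamma>(2) by (simp add: G)
    qed
    have g: "(\<integral>\<^sup>+w. ennreal (g w powr p) \<partial>G) \<le> ennreal (s powr p)"
    proof -
      have "(\<integral>\<^sup>+w. ennreal (g w powr p) \<partial>G) = transport_cost p (distr G \<gamma>' snd)"
        by (simp add: transport_cost_def nn_integral_distr g_def)
      then show ?thesis using \<gamma>'(2) by (simp add: G)
    qed
    have "transport_cost p \<Gamma> = (\<integral>\<^sup>+w. ennreal (norm (fst (fst w) - snd (snd w)) powr p) \<partial>G)"
      by (simp add: transport_cost_def \<Gamma>_def nn_integral_distr)
    also have "\<dots> \<le> (\<integral>\<^sup>+w. ennreal (((f w + \<delta>) + g w) powr p) \<partial>G)"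
    proof (intro nn_integral_mono_AE, use same_cell in eventually_elim)
      fix w :: "('a \<times> 'a) \<times> 'a \<times> 'a"
      assume "\<kappa> (snd (fst w)) = \<kappa> (fst (snd w))"
      then have "norm (snd (fst w) - fst (snd w)) \<le> \<delta>" using cells by (simp add: dist_norm)
      then have "norm (fst (fst w) - snd (snd w)) \<le> f w + \<delta> + g w"
        using norm_triangle_ineq[of "fst (fst w) - snd (fst w)" "snd (fst w) - snd (snd w)"]
          norm_triangle_ineq[of "snd (fst w) - fst (snd w)" "fst (snd w) - snd (snd w)"]
        by (simp add: f_def g_def)
      then show "ennreal (norm (fst (fst w) - snd (snd w)) powr p) \<le> ennreal (((f w + \<delta>) + g w) powr p)"
        using p by (intro ennreal_leI powr_mono2) auto
    qed
    \<comment> \<open>Minkowski is used twice; the inner use treats \<open>\<delta>\<close> as a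
      constant function, whose cost is \<open>\<delta> powr p\<close> since \<open>G\<close> has
      mass one.\<close>
    also have "\<dots> \<le> ennreal ((r + \<delta> + s) powr p)"
    proof (rule nn_integral_minkowski[OF p _ pos(2) _ _ _ _ _ g])
      show "(\<integral>\<^sup>+w. ennreal ((f w + \<delta>) powr p) \<partial>G) \<le> ennreal ((r + \<delta>) powr p)"
        by (rule nn_integral_minkowski[OF p pos(1) pos(3) _ _ _ _ f])
          (use pos in \<open>auto simp: f_def G.emeasure_space_1\<close>)
    qed (use pos in \<open>auto simp: f_def g_def\<close>)
    finally show ?thesis .
  qed
  ultimately show ?thesis by blast
qed

lemma wasserstein_le_triangle:
  assumes p: "1 \<le> p" and nonneg: "0 \<le> r" "0 \<le> s"
    and \<mu>\<nu>: "wasserstein_le p \<mu> \<nu> r" and \<nu>\<rho>: "wasserstein_le p \<nu> \<rho> s"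
  shows "wasserstein_le p \<mu> \<rho> (r + s)"
  unfolding wasserstein_le_def
proof (intro allI impI)
  fix t assume "r + s < t"
  \<comment> \<open>One third of the slack goes to each coupling and one third to the gluing. This
    also makes \<open>r + \<delta>\<close> and \<open>s + \<delta>\<close> positive, as the gluing
    requires, when \<open>r\<close> or \<open>s\<close> is zero.\<close>
  define \<delta> where "\<delta> = (t - (r + s)) / 3"
  have \<delta>: "0 < \<delta>" "(r + \<delta>) + \<delta> + (s + \<delta>) = t" using \<open>r + s < t\<close> by (auto simp: \<delta>_def field_simps)
  obtain \<gamma> \<gamma>' where "\<gamma> \<in> couplings \<mu> \<nu>" "transport_cost p \<gamma> \<le> ennreal ((r + \<delta>) powr p)"
    "\<gamma>' \<in> couplings \<nu> \<rho>" "transport_cost p \<gamma>' \<le> ennreal ((s + \<delta>) powr p)"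
    using \<mu>\<nu> \<nu>\<rho> \<delta>(1) by (metis wasserstein_le_def less_add_same_cancel1)
  then show "\<exists>\<gamma>\<in>couplings \<mu> \<rho>. transport_cost p \<gamma> \<le> ennreal (t powr p)"
    using gluing_estimate[OF p, of "r + \<delta>" "s + \<delta>" \<delta>] nonneg \<delta> by simp
qed

section \<open>Mixtures\<close>

text \<open>Total variation in coupling form. As both vectors sum to one, the mass that has to move
  is the sum of the positive parts of \<open>a - b\<close>, so upper bounds on \<open>a\<close> in
  terms of \<open>b\<close> are enough to keep it small.\<close>

lemma maximal_coupling_weights:
  fixes a b :: "nat \<Rightarrow> real"
  assumes nonneg: "\<And>k. 0 \<le> a k" "\<And>k. 0 \<le> b k"
    and total: "(\<Sum>k\<le>N. a k) = 1" "(\<Sum>k\<le>N. b k) = 1"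
    and beyond: "\<And>k. N < k \<Longrightarrow> a k = 0" "\<And>k. N < k \<Longrightarrow> b k = 0"
  obtains J where "\<And>k l. 0 \<le> J k l" "\<And>k l. N < k \<or> N < l \<Longrightarrow> J k l = 0"
    "\<And>k. (\<Sum>l\<le>N. J k l) = a k" "\<And>l. (\<Sum>k\<le>N. J k l) = b l"
    "(\<Sum>k\<le>N. \<Sum>l\<le>N. if k = l then 0 else J k l) \<le> (\<Sum>k\<le>N. max (a k - b k) 0)"
proof -
  define c where "c k = min (a k) (b k)" for k
  \<comment> \<open>The common mass \<open>c\<close> stays on the diagonal and the remaining mass \<open>\<tau>\<close> is coupled
    independently. For \<open>\<tau> = 0\<close> the quotient in \<open>J\<close> is \<open>0\<close>, which is the right value.\<close>
  define \<tau> where "\<tau> = 1 - (\<Sum>k\<le>N. c k)"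
  define J where "J = (\<lambda>k l. (if k = l then c k else 0) + (a k - c k) * (b l - c l) / \<tau>)"
  have c: "c k \<le> a k" "c k \<le> b k" "0 \<le> c k" for k using nonneg by (auto simp: c_def)
  have \<tau>: "(\<Sum>k\<le>N. a k - c k) = \<tau>" "(\<Sum>k\<le>N. b k - c k) = \<tau>"
    by (simp_all add: sum_subtractf total \<tau>_def)
  have \<tau>_nonneg: "0 \<le> \<tau>" using c by (subst \<tau>(1)[symmetric]) (auto intro: sum_nonneg)
  have degenerate: "a k = c k" "b k = c k" if "\<tau> = 0" for k
  proof -
    have "(\<Sum>k\<le>N. a k - c k) = 0" "(\<Sum>k\<le>N. b k - c k) = 0" using \<tau> that by simp_all
    then have "\<forall>k\<in>{..N}. a k - c k = 0" "\<forall>k\<in>{..N}. b k - c k = 0"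
      using c by (subst (asm) sum_nonneg_eq_0_iff; simp)+
    then have "a k - c k = 0 \<and> b k - c k = 0"
      using beyond[of k] by (cases "k \<le> N") (simp_all add: c_def)
    then show "a k = c k" "b k = c k" by simp_all
  qed
  have zero: "c k = 0" if "N < k" for k using beyond[OF that] by (simp add: c_def)
  show thesis
  proof
    show "0 \<le> J k l" for k l using c \<tau>_nonneg by (auto simp: J_def)
    show "J k l = 0" if "N < k \<or> N < l" for k l
      using that zero beyond by (auto simp: J_def)
    show "(\<Sum>l\<le>N. J k l) = a k" for k
    proof -
      have "(\<Sum>l\<le>N. J k l) = (\<Sum>l\<le>N. if k = l then c k else 0) + (a k - c k) * (\<Sum>l\<le>N. b l - c l) / \<tau>"
        by (simp add: J_def sum.distrib sum_distrib_left sum_divide_distrib)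
      also have "(\<Sum>l\<le>N. if k = l then c k else 0) = c k" using zero[of k] by (simp add: not_le)
      finally show ?thesis using degenerate[of k] by (cases "\<tau> = 0") (simp_all add: \<tau>)
    qed
    show "(\<Sum>k\<le>N. J k l) = b l" for l
    proof -
      have "(\<Sum>k\<le>N. J k l) = (\<Sum>k\<le>N. if k = l then c k else 0) + (\<Sum>k\<le>N. a k - c k) * (b l - c l) / \<tau>"
        by (simp add: J_def sum.distrib sum_distrib_right sum_divide_distrib)
      also have "(\<Sum>k\<le>N. if k = l then c k else 0) = c l" using zero[of l] by (simp add: not_le)
      finally show ?thesis using degenerate[of l] by (cases "\<tau> = 0") (simp_all add: \<tau>)
    qed
    have "(\<Sum>k\<le>N. \<Sum>l\<le>N. if k = l then 0 else J k l) \<le> (\<Sum>k\<le>N. \<Sum>l\<le>N. (a k - c k) * (b l - c l) / \<tau>)"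
      using c \<tau>_nonneg by (intro sum_mono) (auto simp: J_def)
    also have "\<dots> = (\<Sum>k\<le>N. a k - c k) * (\<Sum>l\<le>N. b l - c l) / \<tau>"
      by (simp only: sum_product sum_divide_distrib)
    also have "\<dots> = (\<Sum>k\<le>N. a k - c k)" by (simp add: \<tau>)
    also have "\<dots> = (\<Sum>k\<le>N. max (a k - b k) 0)"
      by (intro sum.cong) (auto simp: c_def)
    finally show "(\<Sum>k\<le>N. \<Sum>l\<le>N. if k = l then 0 else J k l) \<le> (\<Sum>k\<le>N. max (a k - b k) 0)" .
  qed
qed

text \<open>The maximal coupling of the label laws, lifted to the points. Each of the
  \<open>Suc N\<close> labels contributes at most \<open>\<eta>\<close> to the mass that changes
  cell.\<close>

lemma coupling_bounded_cells:
  fixes \<mu> \<nu> :: "'a::euclidean_space measure"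
  assumes \<mu>: "sets \<mu> = sets borel" "prob_space \<mu>" and \<nu>: "sets \<nu> = sets borel" "prob_space \<nu>"
    and \<kappa>[measurable]: "\<kappa> \<in> borel \<rightarrow>\<^sub>M count_space UNIV" and range: "\<And>x. \<kappa> x \<le> N"
    and \<eta>: "0 \<le> \<eta>"
    and close: "\<And>k. k \<le> N \<Longrightarrow> measure \<mu> (\<kappa> -` {k}) \<le> measure \<nu> (\<kappa> -` {k}) + \<eta>"
  obtains \<gamma> where "\<gamma> \<in> couplings \<mu> \<nu>"
    "(\<integral>\<^sup>+xy. (if \<kappa> (fst xy) = \<kappa> (snd xy) then 0 else 1) \<partial>\<gamma>) \<le> ennreal (real (Suc N) * \<eta>)"
proof -
  interpret \<mu>: prob_space \<mu> by fact
  interpret \<nu>: prob_space \<nu> by fact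
  have space: "space \<mu> = UNIV" "space \<nu> = UNIV"
    using sets_eq_imp_space_eq[OF \<mu>(1)] sets_eq_imp_space_eq[OF \<nu>(1)] by simp_all
  note [measurable_cong] = \<mu>(1) \<nu>(1)
  have cell: "\<kappa> -` {k} \<in> sets borel" for k
    using measurable_sets[OF \<kappa>, of "{k}"] by simp
  have total: "(\<Sum>k\<le>N. measure \<rho> (\<kappa> -` {k})) = 1"
    if "prob_space \<rho>" "sets \<rho> = sets borel" "space \<rho> = UNIV" for \<rho> :: "'a measure"
  proof -
    interpret \<rho>: prob_space \<rho> by fact
    have "(\<Union>k\<le>N. \<kappa> -` {k}) = UNIV" using range by auto
    moreover have "measure \<rho> (\<Union>k\<le>N. \<kappa> -` {k}) = (\<Sum>k\<le>N. measure \<rho> (\<kappa> -` {k}))"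
      using cell that by (intro \<rho>.finite_measure_finite_Union) (auto simp: disjoint_family_on_def)
    ultimately show ?thesis using \<rho>.prob_space that by simp
  qed
  have empty: "measure \<rho> (\<kappa> -` {k}) = 0" if "N < k" for \<rho> k
  proof -
    have "\<kappa> -` {k} = {}" using range that by (auto simp: leD)
    then show ?thesis by simp
  qed
  show thesis
  proof (rule maximal_coupling_weights[of "\<lambda>k. measure \<mu> (\<kappa> -` {k})" "\<lambda>k. measure \<nu> (\<kappa> -` {k})" N,
        OF measure_nonneg measure_nonneg total[OF \<mu>(2,1) space(1)] total[OF \<nu>(2,1) space(2)] empty empty])
    fix J :: "nat \<Rightarrow> nat \<Rightarrow> real"
    assume J: "\<And>k l. 0 \<le> J k l" "\<And>k l. N < k \<or> N < l \<Longrightarrow> J k l = 0"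
      "\<And>k. (\<Sum>l\<le>N. J k l) = measure \<mu> (\<kappa> -` {k})" "\<And>l. (\<Sum>k\<le>N. J k l) = measure \<nu> (\<kappa> -` {l})"
      "(\<Sum>k\<le>N. \<Sum>l\<le>N. if k = l then 0 else J k l) \<le>
         (\<Sum>k\<le>N. max (measure \<mu> (\<kappa> -` {k}) - measure \<nu> (\<kappa> -` {k})) 0)"
    have row: "(\<Sum>l. ennreal (J k l)) = emeasure \<mu> (\<kappa> -` {k} \<inter> space \<mu>)" for k
    proof -
      have "(\<Sum>l. ennreal (J k l)) = (\<Sum>l\<le>N. ennreal (J k l))"
        by (rule suminf_finite) (simp_all add: J(2))
      also have "\<dots> = ennreal (\<Sum>l\<le>N. J k l)" by (rule sum_ennreal) (rule J(1))
      finally show ?thesis by (simp add: J(3) space \<mu>.emeasure_eq_measure)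
    qed
    have col: "(\<Sum>k. ennreal (J k l)) = emeasure \<nu> (\<kappa> -` {l} \<inter> space \<nu>)" for l
    proof -
      have "(\<Sum>k. ennreal (J k l)) = (\<Sum>k\<le>N. ennreal (J k l))"
        by (rule suminf_finite) (simp_all add: J(2))
      also have "\<dots> = ennreal (\<Sum>k\<le>N. J k l)" by (rule sum_ennreal) (rule J(1))
      finally show ?thesis by (simp add: J(4) space \<nu>.emeasure_eq_measure)
    qed
    obtain G where G: "sets G = sets (\<mu> \<Otimes>\<^sub>M \<nu>)" "distr G \<mu> fst = \<mu>" "distr G \<nu> snd = \<nu>"
      and law: "\<And>u. (\<integral>\<^sup>+xy. u (\<kappa> (fst xy)) (\<kappa> (snd xy)) \<partial>G) = (\<Sum>k. \<Sum>l. u k l * ennreal (J k l))"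
      by (rule coupling_along_nat_valued_maps[of \<mu> \<nu> \<kappa> \<kappa> "\<lambda>k l. ennreal (J k l)"])
        (auto simp: row col \<mu>(2) \<nu>(2))
    have [measurable]: "fst \<in> G \<rightarrow>\<^sub>M \<mu>" "snd \<in> G \<rightarrow>\<^sub>M \<nu>"
      by (simp_all add: measurable_cong_sets[OF G(1) refl])
    have "distr G borel fst = distr G \<mu> fst" "distr G borel snd = distr G \<nu> snd"
      by (intro distr_cong; simp add: \<mu> \<nu>)+
    moreover have "prob_space G"
      using \<mu>(2) prob_space_distrD[of fst G \<mu>] by (simp add: G)
    ultimately have "G \<in> couplings \<mu> \<nu>"
      using sets_pair_borel[OF \<mu>(1) \<nu>(1)] by (simp add: couplings_def G)
    moreover have "(\<integral>\<^sup>+xy. (if \<kappa> (fst xy) = \<kappa> (snd xy) then 0 else 1) \<partial>G) \<le> ennreal (real (Suc N) * \<eta>)"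
    proof -
      define v where "v k l = (if k = l then 0 else J k l)" for k l
      have v: "0 \<le> v k l" "N < k \<or> N < l \<Longrightarrow> v k l = 0" for k l using J by (auto simp: v_def)
      have "(\<integral>\<^sup>+xy. (if \<kappa> (fst xy) = \<kappa> (snd xy) then 0 else 1) \<partial>G) =
          (\<Sum>k. \<Sum>l. (if k = l then 0 else 1) * ennreal (J k l))"
        by (rule law)
      also have "\<dots> = (\<Sum>k. \<Sum>l. ennreal (v k l))"
        by (intro suminf_cong) (auto simp: v_def)
      also have "\<dots> = (\<Sum>k. \<Sum>l\<le>N. ennreal (v k l))"
        by (intro suminf_cong suminf_finite) (auto simp: v)
      also have "\<dots> = (\<Sum>k\<le>N. \<Sum>l\<le>N. ennreal (v k l))"
        by (intro suminf_finite) (auto simp: v)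
      also have "\<dots> = ennreal (\<Sum>k\<le>N. \<Sum>l\<le>N. v k l)"
        by (simp add: v sum_nonneg)
      also have "\<dots> \<le> ennreal (\<Sum>k\<le>N. max (measure \<mu> (\<kappa> -` {k}) - measure \<nu> (\<kappa> -` {k})) 0)"
        using J(5) by (intro ennreal_leI) (simp add: v_def)
      also have "\<dots> \<le> ennreal (\<Sum>k\<le>N. \<eta>)"
        using close \<eta> by (intro ennreal_leI sum_mono) (auto simp: algebra_simps)
      finally show ?thesis by simp
    qed
    ultimately show thesis by (rule that)
  qed
qed

section \<open>Wasserstein neighbourhoods given by test functions\<close>

text \<open>Truncating labels at \<open>N\<close> merges all far cells into one and leaves finitely
  many. Points in a common near cell pay the first term, points in distinct near cells the second,
  far points the third. If exactly one point is far, the truncated labels differ, so the second term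
  pays for the near point. The factor \<open>2 powr p\<close> serves both the bound
  \<open>(2 * R) powr p\<close> and the triangle inequality.\<close>

lemma powr_dist_le_cells:
  fixes x y :: "'a::euclidean_space" and \<kappa> :: "'a \<Rightarrow> nat"
  assumes p: "1 \<le> p" and R: "0 \<le> R"
    and cells: "\<And>x y. \<kappa> x = \<kappa> y \<Longrightarrow> dist x y \<le> \<delta>"
    and bounded: "\<And>x. \<kappa> x < N \<Longrightarrow> norm x \<le> R"
  defines "t \<equiv> \<lambda>x. if N \<le> \<kappa> x then norm x powr p else 0"
  shows "norm (x - y) powr p \<le> \<delta> powr p +
    2 powr p * R powr p * (if min (\<kappa> x) N = min (\<kappa> y) N then 0 else 1) + 2 powr p * (t x + t y)"
proof -
  have triangle: "norm (x - y) powr p \<le> 2 powr p * (norm x powr p + norm y powr p)"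
  proof -
    have "norm (x - y) powr p \<le> (norm x + norm y) powr p"
      using p by (intro powr_mono2 norm_triangle_ineq4) auto
    also have "\<dots> \<le> 2 powr (p - 1) * (norm x powr p + norm y powr p)"
      using p by (intro powr_add_le) auto
    also have "\<dots> \<le> 2 powr p * (norm x powr p + norm y powr p)"
      by (intro mult_right_mono powr_mono) auto
    finally show ?thesis .
  qed
  have bounded': "norm x powr p \<le> R powr p" if "\<kappa> x < N" for x
    using p bounded[OF that] by (intro powr_mono2) auto
  consider "\<kappa> x = \<kappa> y" "\<kappa> x < N" | "\<kappa> x \<noteq> \<kappa> y" "\<kappa> x < N" "\<kappa> y < N"
    | "N \<le> \<kappa> x" "N \<le> \<kappa> y" | "N \<le> \<kappa> x" "\<kappa> y < N" | "N \<le> \<kappa> y" "\<kappa> x < N"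
    by linarith
  then show ?thesis
  proof cases
    case 1
    then have "norm (x - y) powr p \<le> \<delta> powr p"
      using p cells[of x y] by (intro powr_mono2) (auto simp: dist_norm)
    then show ?thesis using 1 by (simp add: t_def)
  next
    case 2
    have "norm (x - y) powr p \<le> (2 * R) powr p"
      using p norm_triangle_ineq4[of x y] bounded[of x] bounded[of y] 2 by (intro powr_mono2) auto
    then show ?thesis using 2 R by (simp add: t_def powr_mult add_increasing)
  next
    case 3
    then show ?thesis using triangle by (simp add: t_def add_increasing)
  next
    case 4
    have "2 powr p * norm y powr p \<le> 2 powr p * R powr p"
      using bounded'[of y] 4 by (intro mult_left_mono) simp_all
    then have "norm (x - y) powr p \<le> \<delta> powr p + 2 powr p * R powr p + 2 powr p * norm x powr p"
      using triangle powr_ge_zero[of \<delta> p] unfolding distrib_left by linarith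
    then show ?thesis using 4 by (simp add: t_def min_def)
  next
    case 5
    have "2 powr p * norm x powr p \<le> 2 powr p * R powr p"
      using bounded'[of x] 5 by (intro mult_left_mono) simp_all
    then have "norm (x - y) powr p \<le> \<delta> powr p + 2 powr p * R powr p + 2 powr p * norm y powr p"
      using triangle powr_ge_zero[of \<delta> p] unfolding distrib_left by linarith
    then show ?thesis using 5 by (simp add: t_def min_def)
  qed
qed

text \<open>Every point has a finite label, so the truncated integrands eventually vanish pointwise,
  and the moment of \<open>\<mu>\<close> dominates them.\<close>

lemma small_tail:
  assumes \<mu>: "\<mu> \<in> finite_moment_measures p"
    and \<kappa>: "\<kappa> \<in> borel \<rightarrow>\<^sub>M count_space (UNIV :: nat set)" and q: "0 < q"
  obtains N where "(\<integral>\<^sup>+x. ennreal (if N \<le> \<kappa> x then norm x powr p else 0) \<partial>\<mu>) \<le> ennreal q"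
proof -
  have [measurable_cong]: "sets \<mu> = sets borel" and "integrable \<mu> (\<lambda>x. norm x powr p)"
    using \<mu> by (simp_all add: finite_moment_measures_def)
  then have fin: "(\<integral>\<^sup>+x. ennreal (norm x powr p) \<partial>\<mu>) < \<infinity>"
    by (simp add: integrable_iff_bounded)
  note [measurable] = \<kappa>
  have "(\<lambda>n. \<integral>\<^sup>+x. ennreal (if n \<le> \<kappa> x then norm x powr p else 0) \<partial>\<mu>) \<longlonglongrightarrow> (\<integral>\<^sup>+x. 0 \<partial>\<mu>)"
  proof (rule nn_integral_dominated_convergence[where w = "\<lambda>x. ennreal (norm x powr p)"])
    show "AE x in \<mu>. (\<lambda>n. ennreal (if n \<le> \<kappa> x then norm x powr p else 0)) \<longlonglongrightarrow> 0"
    proof (rule AE_I2)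
      fix x
      have "\<forall>\<^sub>F n in sequentially. ennreal (if n \<le> \<kappa> x then norm x powr p else 0) = 0"
        using eventually_gt_at_top[of "\<kappa> x"] by eventually_elim simp
      then show "(\<lambda>n. ennreal (if n \<le> \<kappa> x then norm x powr p else 0)) \<longlonglongrightarrow> 0"
        by (rule tendsto_eventually)
    qed
  qed (use fin in auto)
  then have "\<forall>\<^sub>F n in sequentially.
      (\<integral>\<^sup>+x. ennreal (if n \<le> \<kappa> x then norm x powr p else 0) \<partial>\<mu>) < ennreal q"
    using q by (intro order_tendstoD(2)[where y = 0]) auto
  then obtain N where "(\<integral>\<^sup>+x. ennreal (if N \<le> \<kappa> x then norm x powr p else 0) \<partial>\<mu>) < ennreal q"
    by (auto simp: eventually_sequentially)
  then show thesis using that[of N] by simp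
qed

text \<open>Similar cell masses let most of the mass stay in its cell. What moves costs at most a
  multiple of \<open>R powr p\<close> or is charged to the tails. The tail of \<open>\<mu>\<close>
  is controlled through the last test function, so only the centre \<open>\<nu>\<close> brings a
  moment assumption.\<close>

lemma wasserstein_neighbourhood:
  fixes \<nu> :: "'a::euclidean_space measure"
  assumes p: "1 \<le> p" and \<nu>: "\<nu> \<in> finite_moment_measures p" and e: "0 < e"
  obtains n and f :: "nat \<Rightarrow> 'a \<Rightarrow> ennreal" and \<eta> where "0 < \<eta>"
    "\<And>i. f i \<in> borel_measurable borel"
    "\<And>\<mu>. sets \<mu> = sets borel \<Longrightarrow> prob_space \<mu> \<Longrightarrow>
      (\<And>i. i < n \<Longrightarrow> (\<integral>\<^sup>+x. f i x \<partial>\<mu>) \<le> (\<integral>\<^sup>+x. f i x \<partial>\<nu>) + ennreal \<eta>) \<Longrightarrow>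
      \<exists>\<gamma>\<in>couplings \<mu> \<nu>. transport_cost p \<gamma> \<le> ennreal (e powr p)"
proof -
  have \<nu>_borel: "sets \<nu> = sets borel" and \<nu>_prob: "prob_space \<nu>"
    using \<nu> by (simp_all add: finite_moment_measures_def)
  note [measurable_cong] = \<nu>_borel
  \<comment> \<open>The budget \<open>E\<close> is spent as follows: a quarter inside cells, a
    quarter on changes of cell, three eighths on the two tails.\<close>
  define E where "E = e powr p"
  have E: "0 < E" using e by (simp add: E_def)
  \<comment> \<open>Since \<open>p \<ge> 1\<close>, dividing the radius by 4 divides its power by at
    least 4.\<close>
  define \<delta> where "\<delta> = e / 4"
  have "0 < \<delta>" using e by (simp add: \<delta>_def)
  have \<delta>_le: "\<delta> powr p \<le> E / 4"
  proof -
    have "4 powr 1 \<le> (4::real) powr p" using p by (intro powr_mono) auto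
    then show ?thesis using e by (simp add: \<delta>_def E_def powr_divide field_simps)
  qed
  obtain \<kappa> :: "'a \<Rightarrow> nat" where [measurable]: "\<kappa> \<in> borel \<rightarrow>\<^sub>M count_space UNIV"
    and cells: "\<And>x y. \<kappa> x = \<kappa> y \<Longrightarrow> dist x y \<le> \<delta>"
    using exists_small_cells[OF \<open>0 < \<delta>\<close>] by metis
  \<comment> \<open>The tail of \<open>\<nu>\<close> will be at most \<open>q\<close> and that of
    \<open>\<mu>\<close> at most \<open>q + \<eta> \<le> 2 * q\<close>; the factor
    \<open>2 powr p\<close> turns the total into \<open>3 / 8 * E\<close>.\<close>
  define q where "q = E / (8 * 2 powr p)"
  have q: "0 < q" using E by (simp add: q_def)
  obtain N where tail: "(\<integral>\<^sup>+x. ennreal (if N \<le> \<kappa> x then norm x powr p else 0) \<partial>\<nu>) \<le> ennreal q"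
    using small_tail[OF \<nu> _ q, of \<kappa>] by auto
  define t where "t x = (if N \<le> \<kappa> x then norm x powr p else 0)" for x
  have [measurable]: "t \<in> borel_measurable borel" by (simp add: t_def[abs_def])
  \<comment> \<open>Each of the finitely many near cells lies in a ball around any of its points;
    for an empty cell the chosen centre is arbitrary and the inclusion trivial.\<close>
  have "bounded (\<Union>k<N. \<kappa> -` {k})"
  proof (intro bounded_UN ballI)
    fix k
    have "dist (SOME x. \<kappa> x = k) y \<le> \<delta>" if "\<kappa> y = k" for y
      using cells[of "SOME x. \<kappa> x = k" y] someI[of "\<lambda>x. \<kappa> x = k" y] that by simp
    then have "\<kappa> -` {k} \<subseteq> cball (SOME x. \<kappa> x = k) \<delta>" by auto
    then show "bounded (\<kappa> -` {k})" by (rule bounded_subset[OF bounded_cball])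
  qed simp
  then obtain R where R: "0 < R" "\<And>x. \<kappa> x < N \<Longrightarrow> norm x \<le> R"
    by (auto simp: bounded_pos)
  define C where "C = 2 powr p * R powr p"
  have C: "0 < C" using R by (simp add: C_def)
  \<comment> \<open>The first bound protects the tail of \<open>\<mu>\<close>, the second limits
    \<open>Suc N\<close> changes of cell at price \<open>C\<close> each.\<close>
  define \<eta> where "\<eta> = min q (E / (4 * C * Suc N))"
  have \<eta>: "0 < \<eta>" "\<eta> \<le> q" "C * (Suc N * \<eta>) \<le> E / 4"
  proof -
    show "0 < \<eta>" "\<eta> \<le> q" using q E C by (auto simp: \<eta>_def)
    have "\<eta> \<le> E / (4 * C * Suc N)" by (simp add: \<eta>_def)
    then show "C * (Suc N * \<eta>) \<le> E / 4" using C by (simp add: field_simps del: of_nat_Suc)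
  qed
  define \<kappa>' where "\<kappa>' x = min (\<kappa> x) N" for x
  have \<kappa>'[measurable]: "\<kappa>' \<in> borel \<rightarrow>\<^sub>M count_space UNIV" and \<kappa>'_le: "\<kappa>' x \<le> N" for x
    unfolding \<kappa>'_def[abs_def] by simp_all
  \<comment> \<open>Indices up to \<open>N\<close> test the masses of the truncated cells and index
    \<open>N + 1\<close> tests the tail moment, which makes \<open>N + 2\<close> test
    functions.\<close>
  define f where "f i = (if i \<le> N then indicator (\<kappa>' -` {i}) else (\<lambda>x. ennreal (t x)))" for i
  have cell[measurable]: "\<kappa>' -` {k} \<in> sets borel" for k
    using measurable_sets[of \<kappa>' borel "count_space UNIV" "{k}"] by simp
  show thesis
  proof
    show "0 < \<eta>" by fact
    show "f i \<in> borel_measurable borel" for i by (simp add: f_def)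
    fix \<mu> :: "'a measure"
    assume \<mu>: "sets \<mu> = sets borel" "prob_space \<mu>"
      and close: "\<And>i. i < N + 2 \<Longrightarrow> (\<integral>\<^sup>+x. f i x \<partial>\<mu>) \<le> (\<integral>\<^sup>+x. f i x \<partial>\<nu>) + ennreal \<eta>"
    interpret \<mu>: prob_space \<mu> by fact
    interpret \<nu>: prob_space \<nu> by fact
    note [measurable_cong] = \<mu>(1)
    have cells_close: "measure \<mu> (\<kappa>' -` {k}) \<le> measure \<nu> (\<kappa>' -` {k}) + \<eta>" if "k \<le> N" for k
      using close[of k] that \<eta>(1)
      by (simp add: f_def \<mu>.emeasure_eq_measure \<nu>.emeasure_eq_measure flip: ennreal_plus)
    obtain \<gamma> where \<gamma>: "\<gamma> \<in> couplings \<mu> \<nu>"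
      and diff: "(\<integral>\<^sup>+xy. (if \<kappa>' (fst xy) = \<kappa>' (snd xy) then 0 else 1) \<partial>\<gamma>) \<le> ennreal (real (Suc N) * \<eta>)"
      by (rule coupling_bounded_cells[OF \<mu> \<nu>_borel \<nu>_prob \<kappa>' \<kappa>'_le less_imp_le[OF \<eta>(1)] cells_close])
    note D = couplingsD[OF \<gamma>]
    interpret \<gamma>: prob_space \<gamma> by fact
    note [measurable] = measurable_pair_borel[OF D(1)]
    define d :: "'a \<times> 'a \<Rightarrow> ennreal" where "d xy = (if \<kappa>' (fst xy) = \<kappa>' (snd xy) then 0 else 1)" for xy
    have [measurable]: "d \<in> borel_measurable \<gamma>"
      unfolding d_def[abs_def]
      by (rule measurable_nat_pair[where u = "\<lambda>k l. if k = l then 0 else 1"])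
        (intro measurable_compose[OF _ \<kappa>'] measurable_pair_borel[OF D(1)])+
    have tail_\<mu>: "(\<integral>\<^sup>+x. ennreal (t x) \<partial>\<mu>) \<le> ennreal (2 * q)"
    proof -
      have "(\<integral>\<^sup>+x. ennreal (t x) \<partial>\<mu>) \<le> (\<integral>\<^sup>+x. ennreal (t x) \<partial>\<nu>) + ennreal \<eta>"
        using close[of "Suc N"] by (simp add: f_def)
      also have "\<dots> \<le> ennreal q + ennreal q"
        using tail \<eta>(2) by (intro add_mono ennreal_leI) (simp_all add: t_def)
      finally show ?thesis using q by (simp flip: ennreal_plus)
    qed
    have fst: "(\<integral>\<^sup>+xy. ennreal (t (fst xy)) \<partial>\<gamma>) = (\<integral>\<^sup>+x. ennreal (t x) \<partial>\<mu>)"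
      by (subst D(3)[symmetric], subst nn_integral_distr) auto
    have snd: "(\<integral>\<^sup>+xy. ennreal (t (snd xy)) \<partial>\<gamma>) = (\<integral>\<^sup>+x. ennreal (t x) \<partial>\<nu>)"
      by (subst D(4)[symmetric], subst nn_integral_distr) auto
    have "transport_cost p \<gamma> \<le> (\<integral>\<^sup>+xy. ennreal (E / 4) +
        (ennreal C * d xy +
         ennreal (2 powr p) * (ennreal (t (fst xy)) + ennreal (t (snd xy)))) \<partial>\<gamma>)"
      unfolding transport_cost_def
    proof (rule nn_integral_mono)
      fix xy :: "'a \<times> 'a"
      define c :: real where "c = (if \<kappa>' (fst xy) = \<kappa>' (snd xy) then 0 else 1)"
      have c: "0 \<le> c" "d xy = ennreal c" by (auto simp: c_def d_def)
      have t: "0 \<le> t x" for x by (simp add: t_def)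
      have "norm (fst xy - snd xy) powr p \<le> \<delta> powr p + C * c + 2 powr p * (t (fst xy) + t (snd xy))"
        unfolding C_def c_def \<kappa>'_def t_def using p R cells by (intro powr_dist_le_cells) auto
      then have "norm (fst xy - snd xy) powr p \<le> E / 4 + (C * c + 2 powr p * (t (fst xy) + t (snd xy)))"
        using \<delta>_le by simp
      then have "ennreal (norm (fst xy - snd xy) powr p) \<le>
          ennreal (E / 4 + (C * c + 2 powr p * (t (fst xy) + t (snd xy))))"
        by (rule ennreal_leI)
      then show "ennreal (norm (fst xy - snd xy) powr p) \<le> ennreal (E / 4) +
          (ennreal C * d xy +
           ennreal (2 powr p) * (ennreal (t (fst xy)) + ennreal (t (snd xy))))"
        unfolding c(2) using E C c(1) t by (simp add: ennreal_mult ennreal_plus)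
    qed
    also have "\<dots> = ennreal (E / 4) +
        (ennreal C * (\<integral>\<^sup>+xy. d xy \<partial>\<gamma>) +
         ennreal (2 powr p) * ((\<integral>\<^sup>+x. ennreal (t x) \<partial>\<mu>) + (\<integral>\<^sup>+x. ennreal (t x) \<partial>\<nu>)))"
      by (simp add: nn_integral_add nn_integral_cmult fst snd \<gamma>.emeasure_space_1)
    also have "\<dots> \<le> ennreal (E / 4) + (ennreal C * ennreal (Suc N * \<eta>) +
        ennreal (2 powr p) * (ennreal (2 * q) + ennreal q))"
      using tail by (intro add_mono mult_left_mono diff[folded d_def] tail_\<mu>) (simp_all add: t_def)
    also have "\<dots> = ennreal (E / 4 + (C * (Suc N * \<eta>) + 2 powr p * (2 * q + q)))"
      using E C less_imp_le[OF \<eta>(1)] q by (simp flip: ennreal_mult ennreal_plus del: of_nat_Suc)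
    also have "\<dots> \<le> ennreal E"
    proof (rule ennreal_leI)
      have "2 powr p * (2 * q + q) = 3 / 8 * E" by (simp add: q_def)
      then show "E / 4 + (C * (Suc N * \<eta>) + 2 powr p * (2 * q + q)) \<le> E" using \<eta>(3) E by linarith
    qed
    finally show "\<exists>\<gamma>\<in>couplings \<mu> \<nu>. transport_cost p \<gamma> \<le> ennreal (e powr p)"
      using \<gamma> by (auto simp: E_def)
  qed
qed

section \<open>Discretising by the values of test functions\<close>

lemma measurable_map_upt:
  fixes c :: "nat \<Rightarrow> 'z \<Rightarrow> 'c::countable"
  assumes c: "\<And>i. c i \<in> Q \<rightarrow>\<^sub>M count_space UNIV"
  shows "(\<lambda>z. map (\<lambda>i. c i z) [0..<n]) \<in> Q \<rightarrow>\<^sub>M count_space UNIV"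
  unfolding measurable_count_space_eq2_countable
proof (intro conjI ballI)
  fix l :: "'c list"
  have "{z \<in> space Q. c i z = l ! i} \<in> sets Q" for i
    using measurable_sets[OF c, of "{l ! i}" i] by (simp add: vimage_def Int_def conj_commute)
  then have "{z \<in> space Q. \<forall>i\<in>{..<n}. c i z = l ! i} \<in> sets Q"
    by (intro sets.sets_Collect_finite_All) simp_all
  moreover have "map (\<lambda>i. c i z) [0..<n] = l \<longleftrightarrow> length l = n \<and> (\<forall>i\<in>{..<n}. c i z = l ! i)" for z
    unfolding list_eq_iff_nth_eq by auto
  then have "(\<lambda>z. map (\<lambda>i. c i z) [0..<n]) -` {l} \<inter> space Q =
      (if length l = n then {z \<in> space Q. \<forall>i\<in>{..<n}. c i z = l ! i} else {})"
    by (simp add: vimage_def Int_def conj_commute)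
  ultimately show "(\<lambda>z. map (\<lambda>i. c i z) [0..<n]) -` {l} \<inter> space Q \<in> sets Q" by simp
qed simp

text \<open>The space of \<open>Q\<close> carries no topology, so the values of the test functions
  are discretised instead of the points. Finitely many functions keep the set of codes
  countable.\<close>

lemma countably_valued_approximation:
  fixes g :: "nat \<Rightarrow> 'z \<Rightarrow> ennreal" and \<eta> :: real
  assumes ne: "space Q \<noteq> {}" and \<eta>: "0 < \<eta>" and g[measurable]: "\<And>i. g i \<in> borel_measurable Q"
  obtains \<sigma> :: "'z \<Rightarrow> int option list" and \<psi> where
    "\<sigma> \<in> Q \<rightarrow>\<^sub>M count_space UNIV" "\<And>l. \<psi> l \<in> space Q"
    "\<And>z i. z \<in> space Q \<Longrightarrow> i < n \<Longrightarrow> g i (\<psi> (\<sigma> z)) \<le> g i z + ennreal \<eta>"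
proof -
  \<comment> \<open>The list \<open>\<sigma> z\<close> records the values of the test functions at \<open>z\<close> up to precision \<open>\<eta>\<close>, and
    \<open>\<psi>\<close> picks a representative of each level set of \<open>\<sigma>\<close>.\<close>
  define c where "c i z = (if g i z = \<infinity> then None else Some \<lfloor>enn2real (g i z) / \<eta>\<rfloor>)" for i z
  define \<sigma> where "\<sigma> z = map (\<lambda>i. c i z) [0..<n]" for z
  have "c i \<in> Q \<rightarrow>\<^sub>M count_space UNIV" for i
    unfolding c_def[abs_def] by measurable
  then have \<sigma>: "\<sigma> \<in> Q \<rightarrow>\<^sub>M count_space UNIV"
    unfolding \<sigma>_def[abs_def] by (rule measurable_map_upt)
  \<comment> \<open>For lists outside the range of \<open>\<sigma>\<close> any point of
    \<open>space Q\<close> is taken, so that \<open>\<psi>\<close> stays in the space for every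
    list.\<close>
  define \<psi> where
    "\<psi> l = (SOME z. z \<in> space Q \<and> ((\<exists>z\<in>space Q. \<sigma> z = l) \<longrightarrow> \<sigma> z = l))" for l
  have \<psi>: "\<psi> l \<in> space Q \<and> ((\<exists>z\<in>space Q. \<sigma> z = l) \<longrightarrow> \<sigma> (\<psi> l) = l)" for l
    unfolding \<psi>_def by (rule someI_ex) (use ne in blast)
  have approx: "g i (\<psi> (\<sigma> z)) \<le> g i z + ennreal \<eta>" if z: "z \<in> space Q" and i: "i < n" for z i
  proof -
    define z' where "z' = \<psi> (\<sigma> z)"
    have "\<sigma> z' = \<sigma> z" using \<psi> z by (auto simp: z'_def)
    then have "\<sigma> z' ! i = \<sigma> z ! i" by simp
    then have eq: "c i z' = c i z" using i by (simp add: \<sigma>_def)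
    \<comment> \<open>The value \<infinity> has a code of its own, and there the bound is trivial.
      Otherwise equal floors keep the two values within one mesh width
      \<open>\<eta>\<close>.\<close>
    show ?thesis
    proof (cases "g i z = \<infinity>")
      case False
      then have fin: "g i z' \<noteq> \<infinity>" and
        floor: "\<lfloor>enn2real (g i z') / \<eta>\<rfloor> = \<lfloor>enn2real (g i z) / \<eta>\<rfloor>"
        using eq by (auto simp: c_def split: if_splits)
      have "enn2real (g i z') / \<eta> \<le> enn2real (g i z) / \<eta> + 1" using floor by linarith
      then have "enn2real (g i z') \<le> enn2real (g i z) + \<eta>" using \<eta> by (simp add: field_simps)
      then have "ennreal (enn2real (g i z')) \<le> ennreal (enn2real (g i z)) + ennreal \<eta>"
        using \<eta> by (simp add: ennreal_leI flip: ennreal_plus)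
      then show ?thesis using False fin by (simp add: less_top z'_def)
    qed simp
  qed
  show thesis by (rule that[OF \<sigma> conjunct1[OF \<psi>] approx])
qed

section \<open>Averages of a kernel\<close>

lemma bind_prob_algebra:
  assumes "prob_space Q" "K \<in> Q \<rightarrow>\<^sub>M prob_algebra N"
  shows "sets (Q \<bind> K) = sets N" "prob_space (Q \<bind> K)"
proof -
  have "Q \<in> space (prob_algebra Q)" using assms by (simp add: space_prob_algebra)
  then show "sets (Q \<bind> K) = sets N" "prob_space (Q \<bind> K)"
    using assms sets_bind' prob_space_bind' by blast+
qed

text \<open>Staying within \<open>r\<close> of one measure bounds the moments along the kernel
  uniformly, and a uniform bound passes to the average.\<close>

lemma mixture_finite_moment:
  fixes K :: "'z \<Rightarrow> 'a::euclidean_space measure"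
  assumes p: "1 \<le> p" and r: "0 \<le> r" and Q: "prob_space Q"
    and K: "K \<in> Q \<rightarrow>\<^sub>M prob_algebra borel"
    and \<mu>: "\<mu> \<in> finite_moment_measures p"
    and close: "\<And>z. z \<in> space Q \<Longrightarrow> wasserstein_le p \<mu> (K z) r"
  shows "Q \<bind> K \<in> finite_moment_measures p"
proof -
  interpret Q: prob_space Q by fact
  have \<mu>_borel: "sets \<mu> = sets borel" using \<mu> by (simp add: finite_moment_measures_def)
  note [measurable_cong] = \<mu>_borel
  define m where "m = (\<integral>\<^sup>+x. ennreal (norm x powr p) \<partial>\<mu>)"
  have m: "m < \<infinity>"
    using \<mu> by (auto simp: finite_moment_measures_def m_def integrable_iff_bounded)
  \<comment> \<open>The level \<open>r + 1\<close> is an arbitrary choice above \<open>r\<close>;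
    the factor comes from \<open>norm y \<le> norm x + norm (x - y)\<close> and convexity.\<close>
  define B where "B = ennreal (2 powr (p - 1)) * (m + ennreal ((r + 1) powr p))"
  have B: "B < \<infinity>" using m by (simp add: B_def ennreal_mult_less_top)
  have bound: "(\<integral>\<^sup>+y. ennreal (norm y powr p) \<partial>K z) \<le> B" if z: "z \<in> space Q" for z
  proof -
    obtain \<gamma> where \<gamma>: "\<gamma> \<in> couplings \<mu> (K z)" "transport_cost p \<gamma> \<le> ennreal ((r + 1) powr p)"
      using close[OF z] by (auto simp: wasserstein_le_def dest!: spec[of _ "r + 1"])
    note D = couplingsD[OF \<gamma>(1)]
    note [measurable] = measurable_pair_borel[OF D(1)]
    have "(\<integral>\<^sup>+y. ennreal (norm y powr p) \<partial>K z) = (\<integral>\<^sup>+xy. ennreal (norm (snd xy) powr p) \<partial>\<gamma>)"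
      by (subst D(4)[symmetric], subst nn_integral_distr) auto
    also have "\<dots> \<le> (\<integral>\<^sup>+xy. ennreal (2 powr (p - 1)) *
        (ennreal (norm (fst xy) powr p) + ennreal (norm (fst xy - snd xy) powr p)) \<partial>\<gamma>)"
    proof (rule nn_integral_mono)
      fix xy :: "'a \<times> 'a"
      have "norm (snd xy) powr p \<le> (norm (fst xy) + norm (fst xy - snd xy)) powr p"
        using p norm_triangle_ineq4[of "fst xy" "fst xy - snd xy"] by (intro powr_mono2) auto
      also have "\<dots> \<le> 2 powr (p - 1) * (norm (fst xy) powr p + norm (fst xy - snd xy) powr p)"
        using p by (intro powr_add_le) auto
      finally have "ennreal (norm (snd xy) powr p) \<le>
          ennreal (2 powr (p - 1) * (norm (fst xy) powr p + norm (fst xy - snd xy) powr p))"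
        by (rule ennreal_leI)
      then show "ennreal (norm (snd xy) powr p) \<le> ennreal (2 powr (p - 1)) *
          (ennreal (norm (fst xy) powr p) + ennreal (norm (fst xy - snd xy) powr p))"
        by (simp add: ennreal_mult)
    qed
    also have "\<dots> = ennreal (2 powr (p - 1)) *
        ((\<integral>\<^sup>+xy. ennreal (norm (fst xy) powr p) \<partial>\<gamma>) + transport_cost p \<gamma>)"
      by (simp add: nn_integral_cmult nn_integral_add transport_cost_def)
    also have "(\<integral>\<^sup>+xy. ennreal (norm (fst xy) powr p) \<partial>\<gamma>) = m"
      unfolding m_def by (subst D(3)[symmetric], subst nn_integral_distr) auto
    also have "ennreal (2 powr (p - 1)) * (m + transport_cost p \<gamma>) \<le> B"
      unfolding B_def by (intro mult_left_mono add_left_mono \<gamma>(2)) simp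
    finally show ?thesis .
  qed
  have "(\<integral>\<^sup>+y. ennreal (norm y powr p) \<partial>(Q \<bind> K)) =
      (\<integral>\<^sup>+z. \<integral>\<^sup>+y. ennreal (norm y powr p) \<partial>K z \<partial>Q)"
    by (rule nn_integral_bind[OF _ measurable_prob_algebraD[OF K]]) measurable
  also have "\<dots> \<le> (\<integral>\<^sup>+z. B \<partial>Q)" by (intro nn_integral_mono bound)
  also have "\<dots> = B" by (simp add: Q.emeasure_space_1)
  finally have "(\<integral>\<^sup>+y. ennreal (norm y powr p) \<partial>(Q \<bind> K)) < \<infinity>" using B by (rule le_less_trans)
  then show ?thesis
    using bind_prob_algebra[OF Q K]
    by (simp add: finite_moment_measures_def integrable_iff_bounded cong: measurable_cong_sets)
qed

text \<open>Any choice of couplings indexed by a discrete label is a kernel, so near-optimal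
  couplings can be picked label by label and averaged. Marginals and cost are affine in the
  coupling.\<close>

lemma wasserstein_le_mixture_countable:
  fixes K :: "'c \<Rightarrow> 'a::euclidean_space measure"
  assumes Q: "prob_space Q" and \<sigma>: "\<sigma> \<in> Q \<rightarrow>\<^sub>M count_space UNIV"
    and close: "\<And>l. wasserstein_le p \<mu> (K l) r"
  shows "wasserstein_le p \<mu> (Q \<bind> (\<lambda>z. K (\<sigma> z))) r"
  unfolding wasserstein_le_def
proof (intro allI impI)
  interpret Q: prob_space Q by fact
  fix s assume "r < s"
  then have "\<exists>\<gamma>. \<gamma> \<in> couplings \<mu> (K l) \<and> transport_cost p \<gamma> \<le> ennreal (s powr p)" for l
    using close by (auto simp: wasserstein_le_def)
  then obtain \<gamma> where \<gamma>: "\<And>l. \<gamma> l \<in> couplings \<mu> (K l)"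
    and cost: "\<And>l. transport_cost p (\<gamma> l) \<le> ennreal (s powr p)"
    by metis
  note D = couplingsD[OF \<gamma>]
  define \<Gamma> where "\<Gamma> = Q \<bind> (\<lambda>z. \<gamma> (\<sigma> z))"
  have kernel: "(\<lambda>z. \<gamma> (\<sigma> z)) \<in> Q \<rightarrow>\<^sub>M prob_algebra borel"
    by (rule measurable_compose[OF \<sigma>]) (simp add: space_prob_algebra D)
  note kernel' = measurable_prob_algebraD[OF kernel]
  note [measurable] = measurable_pair_borel[of borel, OF refl]
  have "distr \<Gamma> borel fst = Q \<bind> (\<lambda>z. \<mu>)" "distr \<Gamma> borel snd = Q \<bind> (\<lambda>z. K (\<sigma> z))"
    unfolding \<Gamma>_def by (subst distr_bind[OF kernel' Q.not_empty]; simp add: D(3,4))+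
  moreover have "Q \<bind> (\<lambda>z. \<mu>) = \<mu>"
  proof -
    \<comment> \<open>\<open>\<mu>\<close> is a probability measure because it is a marginal of any
      one of the couplings; the index is immaterial.\<close>
    have "prob_space (distr (\<gamma> undefined) borel fst)"
      by (intro prob_space.prob_space_distr D(2) measurable_pair_borel D(1))
    then show ?thesis
      using bind_const'[OF Q prob_space_imp_subprob_space] by (simp add: D(3))
  qed
  ultimately have "\<Gamma> \<in> couplings \<mu> (Q \<bind> (\<lambda>z. K (\<sigma> z)))"
    using bind_prob_algebra[OF Q kernel] by (simp add: couplings_def \<Gamma>_def)
  moreover have "transport_cost p \<Gamma> \<le> ennreal (s powr p)"
  proof -
    have "transport_cost p \<Gamma> = (\<integral>\<^sup>+z. transport_cost p (\<gamma> (\<sigma> z)) \<partial>Q)"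
      unfolding transport_cost_def \<Gamma>_def by (rule nn_integral_bind[OF _ kernel']) measurable
    also have "\<dots> \<le> (\<integral>\<^sup>+z. ennreal (s powr p) \<partial>Q)" by (intro nn_integral_mono cost)
    finally show ?thesis by (simp add: Q.emeasure_space_1)
  qed
  ultimately show "\<exists>\<gamma>\<in>couplings \<mu> (Q \<bind> (\<lambda>z. K (\<sigma> z))). transport_cost p \<gamma> \<le> ennreal (s powr p)"
    by blast
qed

text \<open>The neighbourhood is centred at the mixture \<open>Q \<bind> K\<close> itself, whose
  moment is already known to be finite. A countable mixture of values of the kernel lies in it and
  stays within \<open>r\<close> of \<open>\<mu>\<close>, and the triangle inequality adds only
  \<open>e\<close>.\<close>

lemma wasserstein_le_mixture:
  fixes K :: "'z \<Rightarrow> 'a::euclidean_space measure"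
  assumes p: "1 \<le> p" and r: "0 \<le> r" and Q: "prob_space Q"
    and K: "K \<in> Q \<rightarrow>\<^sub>M prob_algebra borel"
    and \<mu>: "\<mu> \<in> finite_moment_measures p"
    and close: "\<And>z. z \<in> space Q \<Longrightarrow> wasserstein_le p \<mu> (K z) r"
  shows "wasserstein_le p \<mu> (Q \<bind> K) r"
proof -
  interpret Q: prob_space Q by fact
  note K' = measurable_prob_algebraD[OF K]
  have "wasserstein_le p \<mu> (Q \<bind> K) (r + e)" if e: "0 < e" for e
  proof (rule wasserstein_neighbourhood[OF p mixture_finite_moment[OF assms] e])
    fix n and f :: "nat \<Rightarrow> 'a \<Rightarrow> ennreal" and \<eta> :: real
    assume \<eta>: "0 < \<eta>" and f: "\<And>i. f i \<in> borel_measurable borel"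
      and neighbourhood: "\<And>\<nu>. sets \<nu> = sets borel \<Longrightarrow> prob_space \<nu> \<Longrightarrow>
        (\<And>i. i < n \<Longrightarrow> (\<integral>\<^sup>+x. f i x \<partial>\<nu>) \<le> (\<integral>\<^sup>+x. f i x \<partial>(Q \<bind> K)) + ennreal \<eta>) \<Longrightarrow>
        \<exists>\<gamma>\<in>couplings \<nu> (Q \<bind> K). transport_cost p \<gamma> \<le> ennreal (e powr p)"
    define g where "g i z = (\<integral>\<^sup>+x. f i x \<partial>K z)" for i z
    have g[measurable]: "g i \<in> borel_measurable Q" for i
      unfolding g_def[abs_def]
      by (rule measurable_compose[OF K' nn_integral_measurable_subprob_algebra[OF f]])
    show "wasserstein_le p \<mu> (Q \<bind> K) (r + e)"
    proof (rule countably_valued_approximation[OF Q.not_empty \<eta> g, of n])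
      fix \<sigma> :: "'z \<Rightarrow> int option list" and \<psi>
      assume \<sigma>: "\<sigma> \<in> Q \<rightarrow>\<^sub>M count_space UNIV" and \<psi>: "\<And>l. \<psi> l \<in> space Q"
        and approx: "\<And>z i. z \<in> space Q \<Longrightarrow> i < n \<Longrightarrow> g i (\<psi> (\<sigma> z)) \<le> g i z + ennreal \<eta>"
      \<comment> \<open>The kernel is frozen at the representative of each level set of
        \<open>\<sigma>\<close>. Its values are still values of \<open>K\<close> on
        \<open>space Q\<close>, hence within \<open>r\<close> of \<open>\<mu>\<close>, but they now
        depend on a countable label.\<close>
      define \<nu> where "\<nu> = Q \<bind> (\<lambda>z. K (\<psi> (\<sigma> z)))"
      have kernel: "(\<lambda>z. K (\<psi> (\<sigma> z))) \<in> Q \<rightarrow>\<^sub>M prob_algebra borel"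
        using measurable_space[OF K \<psi>] by (intro measurable_compose[OF \<sigma>]) simp
      have "wasserstein_le p \<mu> \<nu> r"
        unfolding \<nu>_def by (rule wasserstein_le_mixture_countable[OF Q \<sigma>]) (intro close \<psi>)
      moreover have "wasserstein_le p \<nu> (Q \<bind> K) e"
      proof -
        have test: "(\<integral>\<^sup>+x. f i x \<partial>\<nu>) \<le> (\<integral>\<^sup>+x. f i x \<partial>(Q \<bind> K)) + ennreal \<eta>" if "i < n" for i
        proof -
          have "(\<integral>\<^sup>+x. f i x \<partial>\<nu>) = (\<integral>\<^sup>+z. g i (\<psi> (\<sigma> z)) \<partial>Q)"
            unfolding \<nu>_def g_def by (rule nn_integral_bind[OF f measurable_prob_algebraD[OF kernel]])
          also have "\<dots> \<le> (\<integral>\<^sup>+z. g i z + ennreal \<eta> \<partial>Q)"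
            using approx that by (intro nn_integral_mono)
          also have "\<dots> = (\<integral>\<^sup>+z. g i z \<partial>Q) + ennreal \<eta>"
            by (simp add: nn_integral_add Q.emeasure_space_1)
          also have "(\<integral>\<^sup>+z. g i z \<partial>Q) = (\<integral>\<^sup>+x. f i x \<partial>(Q \<bind> K))"
            unfolding g_def by (rule nn_integral_bind[OF f K', symmetric])
          finally show ?thesis .
        qed
        have "sets \<nu> = sets borel" "prob_space \<nu>"
          unfolding \<nu>_def by (rule bind_prob_algebra[OF Q kernel])+
        from neighbourhood[OF this test]
        obtain \<gamma> where \<gamma>: "\<gamma> \<in> couplings \<nu> (Q \<bind> K)" "transport_cost p \<gamma> \<le> ennreal (e powr p)"
          by (rule bexE)
        have "transport_cost p \<gamma> \<le> ennreal (s powr p)" if "e < s" for s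
          using \<gamma>(2) by (rule order_trans) (use p e that in \<open>intro ennreal_leI powr_mono2, auto\<close>)
        then show ?thesis using \<gamma>(1) by (auto simp: wasserstein_le_def)
      qed
      ultimately show ?thesis
        using p r e by (intro wasserstein_le_triangle) auto
    qed
  qed
  note * = this
  show ?thesis
    unfolding wasserstein_le_def
  proof (intro allI impI)
    fix s assume "r < s"
    \<comment> \<open>Only half of the slack is used for \<open>e\<close>, since couplings exist
      only at levels strictly above \<open>r + e\<close>.\<close>
    then have "0 < (s - r) / 2" "r + (s - r) / 2 < s" by (simp_all add: field_simps)
    then show "\<exists>\<gamma>\<in>couplings \<mu> (Q \<bind> K). transport_cost p \<gamma> \<le> ennreal (s powr p)"
      using *[of "(s - r) / 2"] unfolding wasserstein_le_def by metis
  qed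
qed

section \<open>Products and conditional laws\<close>

lemma nn_integral_pair_marginals:
  assumes "prob_space A" "prob_space B"
  shows "f \<in> borel_measurable A \<Longrightarrow> (\<integral>\<^sup>+w. f (fst w) \<partial>(A \<Otimes>\<^sub>M B)) = (\<integral>\<^sup>+x. f x \<partial>A)"
    and "g \<in> borel_measurable B \<Longrightarrow> (\<integral>\<^sup>+w. g (snd w) \<partial>(A \<Otimes>\<^sub>M B)) = (\<integral>\<^sup>+y. g y \<partial>B)"
  using nn_integral_distr[of fst "A \<Otimes>\<^sub>M B" A f] nn_integral_distr[of snd "A \<Otimes>\<^sub>M B" B g]
  by (simp_all add: distr_pair_marginals[OF assms])

lemma powr_norm_Pair_le:
  fixes x :: "'a::euclidean_space" and y :: "'b::euclidean_space"
  assumes "1 \<le> p"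
  shows "norm (x, y) powr p \<le> 2 powr (p - 1) * (norm x powr p + norm y powr p)"
proof -
  have "norm (x, y) powr p \<le> (norm x + norm y) powr p"
    using assms norm_Pair_le[of x y] by (intro powr_mono2) auto
  also have "\<dots> \<le> 2 powr (p - 1) * (norm x powr p + norm y powr p)"
    using assms by (intro powr_add_le) auto
  finally show ?thesis .
qed

lemma product_finite_moment:
  fixes \<mu> :: "'a::euclidean_space measure" and \<nu> :: "'b::euclidean_space measure"
  assumes p: "1 \<le> p" and \<mu>: "\<mu> \<in> finite_moment_measures p" and \<nu>: "\<nu> \<in> finite_moment_measures p"
  shows "\<mu> \<Otimes>\<^sub>M \<nu> \<in> finite_moment_measures p"
proof -
  have \<mu>': "sets \<mu> = sets borel" "prob_space \<mu>" "integrable \<mu> (\<lambda>x. norm x powr p)"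
    and \<nu>': "sets \<nu> = sets borel" "prob_space \<nu>" "integrable \<nu> (\<lambda>x. norm x powr p)"
    using \<mu> \<nu> by (simp_all add: finite_moment_measures_def)
  note [measurable_cong] = \<mu>'(1) \<nu>'(1)
  have sets: "sets (\<mu> \<Otimes>\<^sub>M \<nu>) = sets borel" by (rule sets_pair_borel[OF \<mu>'(1) \<nu>'(1)])
  have "(\<integral>\<^sup>+w. ennreal (norm w powr p) \<partial>(\<mu> \<Otimes>\<^sub>M \<nu>)) \<le>
      (\<integral>\<^sup>+w. ennreal (2 powr (p - 1)) * (ennreal (norm (fst w) powr p) + ennreal (norm (snd w) powr p)) \<partial>(\<mu> \<Otimes>\<^sub>M \<nu>))"
  proof (rule nn_integral_mono)
    fix w :: "'a \<times> 'b"
    have "ennreal (norm w powr p) \<le> ennreal (2 powr (p - 1) * (norm (fst w) powr p + norm (snd w) powr p))"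
      using powr_norm_Pair_le[OF p, of "fst w" "snd w"] by (intro ennreal_leI) simp
    then show "ennreal (norm w powr p) \<le>
        ennreal (2 powr (p - 1)) * (ennreal (norm (fst w) powr p) + ennreal (norm (snd w) powr p))"
      by (simp add: ennreal_mult)
  qed
  also have "\<dots> = ennreal (2 powr (p - 1)) *
      ((\<integral>\<^sup>+w. ennreal (norm (fst w) powr p) \<partial>(\<mu> \<Otimes>\<^sub>M \<nu>)) + (\<integral>\<^sup>+w. ennreal (norm (snd w) powr p) \<partial>(\<mu> \<Otimes>\<^sub>M \<nu>)))"
    by (simp add: nn_integral_cmult nn_integral_add)
  also have "(\<integral>\<^sup>+w. ennreal (norm (fst w) powr p) \<partial>(\<mu> \<Otimes>\<^sub>M \<nu>)) = (\<integral>\<^sup>+x. ennreal (norm x powr p) \<partial>\<mu>)"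
    by (rule nn_integral_pair_marginals(1)[OF \<mu>'(2) \<nu>'(2)]) simp
  also have "(\<integral>\<^sup>+w. ennreal (norm (snd w) powr p) \<partial>(\<mu> \<Otimes>\<^sub>M \<nu>)) = (\<integral>\<^sup>+x. ennreal (norm x powr p) \<partial>\<nu>)"
    by (rule nn_integral_pair_marginals(2)[OF \<mu>'(2) \<nu>'(2)]) simp
  also have "ennreal (2 powr (p - 1)) *
      ((\<integral>\<^sup>+x. ennreal (norm x powr p) \<partial>\<mu>) + (\<integral>\<^sup>+x. ennreal (norm x powr p) \<partial>\<nu>)) < \<infinity>"
    using \<mu>'(3) \<nu>'(3) by (simp add: ennreal_mult_less_top integrable_iff_bounded)
  finally show ?thesis
    using prob_space_pair[OF \<mu>'(2) \<nu>'(2)]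
    by (simp add: finite_moment_measures_def sets integrable_iff_bounded measurable_cong_sets[OF sets refl])
qed

text \<open>The two couplings are run independently, and \<open>h\<close> regroups the four
  coordinates into the pair of first points and the pair of second points. The difference is then a
  pair of differences, to which \<open>powr_norm_Pair_le\<close> applies.\<close>

lemma product_coupling:
  fixes \<mu> \<mu>' :: "'a::euclidean_space measure" and \<nu> \<nu>' :: "'b::euclidean_space measure"
  assumes p: "1 \<le> p" and r: "0 \<le> r" and s: "0 \<le> s"
    and \<gamma>: "\<gamma> \<in> couplings \<mu> \<mu>'" "transport_cost p \<gamma> \<le> ennreal r"
    and \<gamma>': "\<gamma>' \<in> couplings \<nu> \<nu>'" "transport_cost p \<gamma>' \<le> ennreal s"
  shows "\<exists>\<Gamma>\<in>couplings (\<mu> \<Otimes>\<^sub>M \<nu>) (\<mu>' \<Otimes>\<^sub>M \<nu>'). transport_cost p \<Gamma> \<le> ennreal (2 powr (p - 1) * (r + s))"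
proof -
  note D = couplingsD[OF \<gamma>(1)] and D' = couplingsD[OF \<gamma>'(1)]
  note fst_snd = measurable_pair_borel[OF D(1)] measurable_pair_borel[OF D'(1)]
  note [measurable] = fst_snd measurable_pair_borel[of borel, OF refl]
  interpret G: prob_space "\<gamma> \<Otimes>\<^sub>M \<gamma>'" by (rule prob_space_pair[OF D(2) D'(2)])
  define h where "h w = ((fst (fst w), fst (snd w)), (snd (fst w), snd (snd w)))"
    for w :: "('a \<times> 'a) \<times> 'b \<times> 'b"
  have h[measurable]: "h \<in> \<gamma> \<Otimes>\<^sub>M \<gamma>' \<rightarrow>\<^sub>M borel"
    unfolding h_def[abs_def] by (simp flip: borel_prod)
  define \<Gamma> where "\<Gamma> = distr (\<gamma> \<Otimes>\<^sub>M \<gamma>') borel h"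
  have "distr \<Gamma> borel fst = distr (\<gamma> \<Otimes>\<^sub>M \<gamma>') (borel \<Otimes>\<^sub>M borel) (\<lambda>(x, y). (fst x, fst y))"
    by (simp add: \<Gamma>_def distr_distr comp_def h_def split_beta' borel_prod)
  also have "\<dots> = distr \<gamma> borel fst \<Otimes>\<^sub>M distr \<gamma>' borel fst"
    using D'(2) by (intro pair_measure_distr[symmetric] fst_snd prob_space_imp_sigma_finite prob_space.prob_space_distr)
  finally have fst_\<Gamma>: "distr \<Gamma> borel fst = \<mu> \<Otimes>\<^sub>M \<nu>" by (simp add: D D')
  have "distr \<Gamma> borel snd = distr (\<gamma> \<Otimes>\<^sub>M \<gamma>') (borel \<Otimes>\<^sub>M borel) (\<lambda>(x, y). (snd x, snd y))"
    by (simp add: \<Gamma>_def distr_distr comp_def h_def split_beta' borel_prod)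
  also have "\<dots> = distr \<gamma> borel snd \<Otimes>\<^sub>M distr \<gamma>' borel snd"
    using D'(2) by (intro pair_measure_distr[symmetric] fst_snd prob_space_imp_sigma_finite prob_space.prob_space_distr)
  finally have snd_\<Gamma>: "distr \<Gamma> borel snd = \<mu>' \<Otimes>\<^sub>M \<nu>'" by (simp add: D D')
  have "\<Gamma> \<in> couplings (\<mu> \<Otimes>\<^sub>M \<nu>) (\<mu>' \<Otimes>\<^sub>M \<nu>')"
    using fst_\<Gamma> snd_\<Gamma> by (simp add: couplings_def) (simp add: \<Gamma>_def G.prob_space_distr)
  moreover have "transport_cost p \<Gamma> \<le> ennreal (2 powr (p - 1) * (r + s))"
  proof -
    define a where "a xy = ennreal (norm (fst xy - snd xy) powr p)" for xy :: "'a \<times> 'a"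
    define b where "b xy = ennreal (norm (fst xy - snd xy) powr p)" for xy :: "'b \<times> 'b"
    have [measurable]: "a \<in> borel_measurable \<gamma>" "b \<in> borel_measurable \<gamma>'"
      unfolding a_def[abs_def] b_def[abs_def] by measurable
    have "transport_cost p \<Gamma> = (\<integral>\<^sup>+w. ennreal (norm (fst (h w) - snd (h w)) powr p) \<partial>(\<gamma> \<Otimes>\<^sub>M \<gamma>'))"
      unfolding transport_cost_def \<Gamma>_def by (rule nn_integral_distr[OF h]) simp
    also have "\<dots> \<le> (\<integral>\<^sup>+w. ennreal (2 powr (p - 1)) * (a (fst w) + b (snd w)) \<partial>(\<gamma> \<Otimes>\<^sub>M \<gamma>'))"
    proof (rule nn_integral_mono)
      fix w :: "('a \<times> 'a) \<times> 'b \<times> 'b"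
      define x y where "x = fst (fst w) - snd (fst w)" and "y = fst (snd w) - snd (snd w)"
      have "fst (h w) - snd (h w) = (x, y)" by (simp add: h_def x_def y_def)
      then have "ennreal (norm (fst (h w) - snd (h w)) powr p) \<le>
          ennreal (2 powr (p - 1) * (norm x powr p + norm y powr p))"
        using powr_norm_Pair_le[OF p] by (simp add: ennreal_leI)
      then show "ennreal (norm (fst (h w) - snd (h w)) powr p) \<le>
          ennreal (2 powr (p - 1)) * (a (fst w) + b (snd w))"
        by (simp add: ennreal_mult a_def b_def x_def y_def)
    qed
    also have "\<dots> = ennreal (2 powr (p - 1)) *
        ((\<integral>\<^sup>+w. a (fst w) \<partial>(\<gamma> \<Otimes>\<^sub>M \<gamma>')) + (\<integral>\<^sup>+w. b (snd w) \<partial>(\<gamma> \<Otimes>\<^sub>M \<gamma>')))"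
      by (simp add: nn_integral_cmult nn_integral_add)
    also have "\<dots> = ennreal (2 powr (p - 1)) * (transport_cost p \<gamma> + transport_cost p \<gamma>')"
      by (simp add: nn_integral_pair_marginals[OF D(2) D'(2)])
         (simp add: transport_cost_def a_def b_def)
    also have "\<dots> \<le> ennreal (2 powr (p - 1)) * (ennreal r + ennreal s)"
      by (intro mult_left_mono add_mono \<gamma>(2) \<gamma>'(2)) simp
    also have "\<dots> = ennreal (2 powr (p - 1) * (r + s))"
      using r s by (simp add: ennreal_mult)
    finally show ?thesis .
  qed
  ultimately show ?thesis by (rule bexI[rotated])
qed

lemma wasserstein_le_product:
  fixes \<mu> \<mu>' :: "'a::euclidean_space measure" and \<nu> \<nu>' :: "'b::euclidean_space measure"
  assumes p: "1 \<le> p" and r: "0 \<le> r" and s: "0 \<le> s"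
    and \<mu>: "wasserstein_le p \<mu> \<mu>' r" and \<nu>: "wasserstein_le p \<nu> \<nu>' s"
  shows "wasserstein_le p (\<mu> \<Otimes>\<^sub>M \<nu>) (\<mu>' \<Otimes>\<^sub>M \<nu>') ((2 powr (p - 1) * (r powr p + s powr p)) powr (1 / p))"
  unfolding wasserstein_le_def
proof (intro allI impI)
  fix t assume t: "(2 powr (p - 1) * (r powr p + s powr p)) powr (1 / p) < t"
  \<comment> \<open>The factors provide couplings only at levels \<open>r + e\<close> and
    \<open>s + e\<close>. \<open>F e\<close> bounds the cost of their product, and it drops below
    \<open>t powr p\<close> for small \<open>e\<close> by continuity from the right.\<close>
  define F where "F e = 2 powr (p - 1) * ((r + e) powr p + (s + e) powr p)" for e
  have "0 < t" using t by (rule le_less_trans[OF powr_ge_zero])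
  have "((2 powr (p - 1) * (r powr p + s powr p)) powr (1 / p)) powr p < t powr p"
    using p t by (intro powr_less_mono2) auto
  then have "2 powr (p - 1) * (r powr p + s powr p) < t powr p"
    using p by (simp add: powr_powr)
  \<comment> \<open>The base may tend to zero, where \<open>powr\<close> converges because the
    exponent is positive and the base is nonnegative to the right of 0.\<close>
  moreover have "(F \<longlongrightarrow> 2 powr (p - 1) * ((r + 0) powr p + (s + 0) powr p)) (at_right 0)"
    unfolding F_def[abs_def] using p r s
    by (intro tendsto_intros tendsto_powr' disjI2) (auto simp: eventually_at_right_less eventually_at_filter)
  ultimately have "\<forall>\<^sub>F e in at_right 0. F e < t powr p"
    by (intro order_tendstoD(2)[of F]) auto
  then have "\<forall>\<^sub>F e in at_right 0. F e < t powr p \<and> 0 < e"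
    using eventually_at_right_less[of "0 :: real"] by eventually_elim simp
  then obtain e where e: "F e < t powr p" "0 < e"
    using eventually_happens[of _ "at_right (0 :: real)"] by (auto simp: trivial_limit_at_right_real)
  obtain \<gamma> where \<gamma>: "\<gamma> \<in> couplings \<mu> \<mu>'" "transport_cost p \<gamma> \<le> ennreal ((r + e) powr p)"
    using \<mu> e(2) unfolding wasserstein_le_def by (metis less_add_same_cancel1)
  obtain \<gamma>' where \<gamma>': "\<gamma>' \<in> couplings \<nu> \<nu>'" "transport_cost p \<gamma>' \<le> ennreal ((s + e) powr p)"
    using \<nu> e(2) unfolding wasserstein_le_def by (metis less_add_same_cancel1)
  obtain \<Gamma> where \<Gamma>: "\<Gamma> \<in> couplings (\<mu> \<Otimes>\<^sub>M \<nu>) (\<mu>' \<Otimes>\<^sub>M \<nu>')" "transport_cost p \<Gamma> \<le> ennreal (F e)"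
    using product_coupling[OF p powr_ge_zero powr_ge_zero \<gamma> \<gamma>'] unfolding F_def by (rule bexE)
  have "transport_cost p \<Gamma> \<le> ennreal (t powr p)"
    using \<Gamma>(2) by (rule order_trans) (use e in \<open>simp add: ennreal_leI\<close>)
  then show "\<exists>\<gamma>\<in>couplings (\<mu> \<Otimes>\<^sub>M \<nu>) (\<mu>' \<Otimes>\<^sub>M \<nu>'). transport_cost p \<gamma> \<le> ennreal (t powr p)"
    using \<Gamma>(1) by (rule bexI)
qed

section \<open>Stability of the distance in both arguments\<close>

lemma wasserstein_nonneg:
  assumes "couplings \<mu> \<nu> \<noteq> {}"
  shows "0 \<le> wasserstein p \<mu> \<nu>"
  unfolding wasserstein_def using assms by (intro cINF_greatest) auto

text \<open>The infimum satisfies its own \<open>wasserstein_le\<close>, attained or not, so two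
  triangle inequalities give one side of the estimate. Exchanging the primed and unprimed measures
  gives the other.\<close>

lemma wasserstein_perturbation:
  fixes \<mu> \<nu> \<mu>' \<nu>' :: "'a::euclidean_space measure"
  assumes p: "1 \<le> p" and nonneg: "0 \<le> r" "0 \<le> s"
    and moments: "\<mu> \<in> finite_moment_measures p" "\<nu> \<in> finite_moment_measures p"
      "\<mu>' \<in> finite_moment_measures p" "\<nu>' \<in> finite_moment_measures p"
    and \<mu>: "wasserstein_le p \<mu> \<mu>' r" and \<nu>: "wasserstein_le p \<nu> \<nu>' s"
  shows "\<bar>wasserstein p \<mu> \<nu> - wasserstein p \<mu>' \<nu>'\<bar> \<le> r + s"
proof -
  have upper: "wasserstein p \<mu>' \<nu>' \<le> r + wasserstein p \<mu> \<nu> + s"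
    if m: "\<mu> \<in> finite_moment_measures p" "\<nu> \<in> finite_moment_measures p"
      "\<mu>' \<in> finite_moment_measures p" "\<nu>' \<in> finite_moment_measures p"
      and c: "wasserstein_le p \<mu> \<mu>' r" "wasserstein_le p \<nu> \<nu>' s" for \<mu> \<nu> \<mu>' \<nu>' :: "'a measure"
  proof -
    have w: "0 \<le> wasserstein p \<mu> \<nu>"
      using product_in_couplings[of \<mu> \<nu>] m
      by (intro wasserstein_nonneg) (auto simp: finite_moment_measures_def)
    then have "wasserstein_le p \<mu> \<nu> (wasserstein p \<mu> \<nu>)"
      using wasserstein_le_iff[OF p w m(1,2)] by simp
    then have "wasserstein_le p \<mu>' \<nu>' (r + wasserstein p \<mu> \<nu> + s)"
      using p nonneg w c
      by (intro wasserstein_le_triangle[where \<nu> = \<nu>] wasserstein_le_triangle[where \<nu> = \<mu>])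
        (auto intro: wasserstein_le_commute)
    then show ?thesis using wasserstein_le_iff[OF p _ m(3,4)] nonneg w by simp
  qed
  from upper[OF moments \<mu> \<nu>]
    upper[OF moments(3,4,1,2) wasserstein_le_commute[OF \<mu>] wasserstein_le_commute[OF \<nu>]]
  show ?thesis by linarith
qed

section \<open>Laws conditioned on a bin\<close>

text \<open>Taking \<open>B = V\<close> in the identity that defines the conditional distribution
  and dividing by the mass of the bin exhibits conditioning as averaging \<open>K\<close> over the
  normalised law of \<open>Z\<close> on \<open>V\<close>.\<close>

lemma law_given_event_eq_bind:
  fixes W :: "'w \<Rightarrow> 'a::euclidean_space" and Z :: "'w \<Rightarrow> 'z::euclidean_space"
  assumes M: "prob_space M" and W: "W \<in> borel_measurable M" and Z: "Z \<in> borel_measurable M"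
    and K: "regular_cond_distr M W Z K"
    and V: "V \<in> sets borel" "V \<subseteq> msupport (distr M borel Z)" "measure (distr M borel Z) V > 0"
  obtains Q where "prob_space Q" "space Q = V" "K \<in> Q \<rightarrow>\<^sub>M prob_algebra borel"
    "law_given_event M W Z V = Q \<bind> K"
proof -
  interpret M: prob_space M by fact
  note [measurable] = W Z V(1)
  define \<zeta> where "\<zeta> = distr M borel Z"
  define S where "S = msupport \<zeta>"
  interpret \<zeta>: prob_space \<zeta> unfolding \<zeta>_def by (rule M.prob_space_distr) fact
  have sets_\<zeta>: "sets \<zeta> = sets borel" "space \<zeta> = UNIV" by (simp_all add: \<zeta>_def)
  have V_sets: "V \<in> sets \<zeta>" using V(1) by (simp add: sets_\<zeta>)
  have pos: "emeasure \<zeta> V \<noteq> 0" "emeasure \<zeta> V \<noteq> \<infinity>"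
    using V(3) by (simp_all add: \<zeta>.emeasure_eq_measure flip: \<zeta>_def)
  \<comment> \<open>The space itself is cut down to \<open>V\<close>, not only the mass.
    \<open>K\<close> is a kernel only on the support, and this way bounds valid on the bin hold at
    every point of \<open>space Q\<close>.\<close>
  define R where "R = restrict_space \<zeta> V"
  have R: "space R = V" "emeasure R V = emeasure \<zeta> V" "V \<in> sets R"
    using V_sets by (simp_all add: R_def space_restrict_space sets_\<zeta> emeasure_restrict_space sets_restrict_space_iff)
  define Q where "Q = uniform_measure R V"
  have Q: "prob_space Q" unfolding Q_def using pos by (intro prob_space_uniform_measure) (simp_all add: R)
  have space_Q: "space Q = V" by (simp add: Q_def R)
  have sets_Q: "sets Q = sets (restrict_space borel V)"
    by (simp add: Q_def R_def sets_restrict_space sets_\<zeta>)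
  have "K \<in> restrict_space borel V \<rightarrow>\<^sub>M prob_algebra borel"
    using K V(2) by (auto simp: regular_cond_distr_def intro: measurable_restrict_mono)
  then have K_Q: "K \<in> Q \<rightarrow>\<^sub>M prob_algebra borel"
    by (simp add: measurable_cong_sets[OF sets_Q refl])
  have "law_given_event M W Z V = Q \<bind> K"
  proof (rule measure_eqI)
    show "sets (law_given_event M W Z V) = sets (Q \<bind> K)"
      by (simp add: law_given_event_def bind_prob_algebra[OF Q K_Q])
    fix A assume "A \<in> sets (law_given_event M W Z V)"
    then have A[measurable]: "A \<in> sets borel" by (simp add: law_given_event_def)
    have event: "Z -` V \<inter> space M \<in> sets M" by measurable
    have "emeasure (law_given_event M W Z V) A =
        emeasure (uniform_measure M (Z -` V \<inter> space M)) (W -` A \<inter> space M)"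
      unfolding law_given_event_def by (subst emeasure_distr) simp_all
    also have "\<dots> = emeasure M (Z -` V \<inter> space M \<inter> (W -` A \<inter> space M)) / emeasure M (Z -` V \<inter> space M)"
      by (rule emeasure_uniform_measure[OF event]) measurable
    also have "emeasure M (Z -` V \<inter> space M) = emeasure \<zeta> V"
      by (simp add: \<zeta>_def emeasure_distr)
    also have "Z -` V \<inter> space M \<inter> (W -` A \<inter> space M) = {w \<in> space M. W w \<in> A \<and> Z w \<in> V}"
      by auto
    also have "emeasure M \<dots> = (\<integral>\<^sup>+z\<in>V \<inter> S. emeasure (K z) A \<partial>\<zeta>)"
      using K A V(1) by (simp add: regular_cond_distr_def \<zeta>_def S_def)
    also have "V \<inter> S = V" using V(2) by (auto simp: S_def \<zeta>_def)
    also have "(\<integral>\<^sup>+z\<in>V. emeasure (K z) A \<partial>\<zeta>) = (\<integral>\<^sup>+z. emeasure (K z) A \<partial>R)"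
      unfolding R_def using V_sets by (subst nn_integral_restrict_space) (simp_all add: sets_\<zeta>)
    also have "\<dots> / emeasure \<zeta> V = (\<integral>\<^sup>+z. emeasure (K z) A \<partial>Q)"
    proof -
      have meas: "(\<lambda>z. emeasure (K z) A) \<in> borel_measurable R"
      proof -
        have "(\<lambda>z. emeasure (K z) A) \<in> borel_measurable Q"
          by (rule measurable_compose[OF measurable_prob_algebraD[OF K_Q] measurable_emeasure_subprob_algebra[OF A]])
        then show ?thesis by (simp add: Q_def)
      qed
      have "(\<integral>\<^sup>+z. emeasure (K z) A \<partial>Q) = (\<integral>\<^sup>+z. emeasure (K z) A * indicator V z \<partial>R) / emeasure R V"
        unfolding Q_def by (rule nn_integral_uniform_measure[OF meas R(3)])
      also have "(\<integral>\<^sup>+z. emeasure (K z) A * indicator V z \<partial>R) = (\<integral>\<^sup>+z. emeasure (K z) A \<partial>R)"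
        by (rule nn_integral_cong) (simp add: R(1))
      finally show ?thesis by (simp add: R(2))
    qed
    also have "\<dots> = emeasure (Q \<bind> K) A"
      by (rule emeasure_bind[OF prob_space.not_empty[OF Q] measurable_prob_algebraD[OF K_Q] A, symmetric])
    finally show "emeasure (law_given_event M W Z V) A = emeasure (Q \<bind> K) A" .
  qed
  then show thesis by (rule that[OF Q space_Q K_Q])
qed

text \<open>Each conditional law on the bin is within \<open>L * d\<close> of the one at
  \<open>z\<close>, and the law given the event averages exactly these.\<close>

lemma lipschitz_law_given_event:
  fixes W :: "'w \<Rightarrow> 'a::euclidean_space" and Z :: "'w \<Rightarrow> 'z::euclidean_space"
  assumes p: "1 \<le> p" and M: "prob_space M"
    and W: "W \<in> borel_measurable M" and Z: "Z \<in> borel_measurable M"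
    and K: "regular_cond_distr M W Z K"
    and V: "V \<in> sets borel" "V \<subseteq> msupport (distr M borel Z)" "measure (distr M borel Z) V > 0"
    and z: "z \<in> V" and d: "\<And>z'. z' \<in> V \<Longrightarrow> dist z z' \<le> d"
    and moment: "\<And>z. z \<in> msupport (distr M borel Z) \<Longrightarrow> K z \<in> finite_moment_measures p"
    and lipschitz: "wasserstein_lipschitz_on p L (msupport (distr M borel Z)) K"
  shows "law_given_event M W Z V \<in> finite_moment_measures p"
    and "wasserstein_le p (K z) (law_given_event M W Z V) (L * d)"
proof -
  have "law_given_event M W Z V \<in> finite_moment_measures p \<and>
    wasserstein_le p (K z) (law_given_event M W Z V) (L * d)"
  proof (rule law_given_event_eq_bind[OF M W Z K V])
    fix Q
    assume Q: "prob_space Q" "space Q = V" "K \<in> Q \<rightarrow>\<^sub>M prob_algebra borel"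
      and law: "law_given_event M W Z V = Q \<bind> K"
    have L: "0 \<le> L" using lipschitz by (simp add: wasserstein_lipschitz_on_def)
    have "0 \<le> d" using d[OF z] by simp
    then have nonneg: "0 \<le> L * d" using L by simp
    have mz: "K z \<in> finite_moment_measures p" using moment V(2) z by blast
    have close: "wasserstein_le p (K z) (K z') (L * d)" if "z' \<in> space Q" for z'
    proof -
      have z': "z' \<in> V" using that Q(2) by simp
      have "wasserstein p (K z) (K z') \<le> L * dist z z'"
        using lipschitz z z' V(2) by (auto simp: wasserstein_lipschitz_on_def)
      also have "\<dots> \<le> L * d" using L d[OF z'] by (rule mult_left_mono[rotated])
      finally show ?thesis
        using wasserstein_le_iff[OF p nonneg mz] moment V(2) z' by blast
    qed
    show ?thesis
      unfolding law
      using mixture_finite_moment[OF p nonneg Q(1,3) mz close] wasserstein_le_mixture[OF p nonneg Q(1,3) mz close]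
      by blast
  qed
  then show "law_given_event M W Z V \<in> finite_moment_measures p"
    "wasserstein_le p (K z) (law_given_event M W Z V) (L * d)" by simp_all
qed

theorem corollary9:
  fixes M :: "'w measure"
    and X :: "'w \<Rightarrow> 'x::euclidean_space"
    and Y :: "'w \<Rightarrow> 'y::euclidean_space"
    and Z :: "'w \<Rightarrow> 'z::euclidean_space"
    and K\<^sub>X\<^sub>Y :: "'z \<Rightarrow> ('x \<times> 'y) measure"
    and K\<^sub>X :: "'z \<Rightarrow> 'x measure"
    and K\<^sub>Y :: "'z \<Rightarrow> 'y measure"
    and p L\<^sub>X\<^sub>Y L\<^sub>X L\<^sub>Y \<epsilon> :: real
    and J :: nat
    and V :: "nat \<Rightarrow> 'z set"
  defines "S \<equiv> msupport (distr M borel Z)"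
    and "D \<equiv> max L\<^sub>X\<^sub>Y ((2 powr (p - 1) * (L\<^sub>X powr p + L\<^sub>Y powr p)) powr (1 / p))"
  assumes p: "1 \<le> p"
    and M: "prob_space M"
    and X: "X \<in> borel_measurable M"
    and Y: "Y \<in> borel_measurable M"
    and Z: "Z \<in> borel_measurable M"
    and compact: "compact S"
    and K\<^sub>X\<^sub>Y: "regular_cond_distr M (\<lambda>w. (X w, Y w)) Z K\<^sub>X\<^sub>Y"
    and K\<^sub>X: "regular_cond_distr M X Z K\<^sub>X"
    and K\<^sub>Y: "regular_cond_distr M Y Z K\<^sub>Y"
    and moment_XY: "\<And>z. z \<in> S \<Longrightarrow> K\<^sub>X\<^sub>Y z \<in> finite_moment_measures p"
    and moment_X: "\<And>z. z \<in> S \<Longrightarrow> K\<^sub>X z \<in> finite_moment_measures p"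
    and moment_Y: "\<And>z. z \<in> S \<Longrightarrow> K\<^sub>Y z \<in> finite_moment_measures p"
    and lipschitz_XY: "wasserstein_lipschitz_on p L\<^sub>X\<^sub>Y S K\<^sub>X\<^sub>Y"
    and lipschitz_X: "wasserstein_lipschitz_on p L\<^sub>X S K\<^sub>X"
    and lipschitz_Y: "wasserstein_lipschitz_on p L\<^sub>Y S K\<^sub>Y"
    and \<epsilon>: "0 < \<epsilon>"
    and bins_measurable: "\<And>j. j \<in> {1..J} \<Longrightarrow> V j \<in> sets borel"
    and bins_disjoint: "disjoint_family_on V {1..J}"
    and bins_cover: "(\<Union>j\<in>{1..J}. V j) = S"
    and bins_positive: "\<And>j. j \<in> {1..J} \<Longrightarrow> measure (distr M borel Z) (V j) > 0"
    and bins_diameter: "\<And>j. j \<in> {1..J} \<Longrightarrow> D \<noteq> 0 \<Longrightarrow> diameter (V j) \<le> \<epsilon> / (4 * D)"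
  shows "\<forall>j\<in>{1..J}. \<forall>z\<^sub>0\<in>V j.
    \<bar>wasserstein p (K\<^sub>X\<^sub>Y z\<^sub>0) (K\<^sub>X z\<^sub>0 \<Otimes>\<^sub>M K\<^sub>Y z\<^sub>0) -
     wasserstein p
       (law_given_event M (\<lambda>w. (X w, Y w)) Z (V j))
       (law_given_event M X Z (V j) \<Otimes>\<^sub>M law_given_event M Y Z (V j))\<bar> \<le> \<epsilon> / 2"
proof (intro ballI)
  fix j z\<^sub>0
  assume j: "j \<in> {1..J}" and z\<^sub>0: "z\<^sub>0 \<in> V j"
  define d where "d = diameter (V j)"
  have V_S: "V j \<subseteq> S" using bins_cover j by auto
  \<comment> \<open>Compactness of the support enters here: \<open>diameter\<close> bounds distances
    only for bounded sets.\<close>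
  then have "bounded (V j)" using compact_imp_bounded[OF compact] bounded_subset by blast
  then have d: "0 \<le> d" "\<And>z. z \<in> V j \<Longrightarrow> dist z\<^sub>0 z \<le> d"
    using z\<^sub>0 by (auto simp: d_def diameter_ge_0 diameter_bounded_bound)
  have L_nonneg: "0 \<le> L\<^sub>X\<^sub>Y" "0 \<le> L\<^sub>X" "0 \<le> L\<^sub>Y"
    using lipschitz_XY lipschitz_X lipschitz_Y by (auto simp: wasserstein_lipschitz_on_def)
  have z\<^sub>0_S: "z\<^sub>0 \<in> S" using z\<^sub>0 V_S by auto
  note bin = bins_measurable[OF j] V_S[unfolded S_def] bins_positive[OF j]
  define P\<^sub>X\<^sub>Y where "P\<^sub>X\<^sub>Y = law_given_event M (\<lambda>w. (X w, Y w)) Z (V j)"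
  define P\<^sub>X where "P\<^sub>X = law_given_event M X Z (V j)"
  define P\<^sub>Y where "P\<^sub>Y = law_given_event M Y Z (V j)"
  have XY: "(\<lambda>w. (X w, Y w)) \<in> borel_measurable M" using X Y by simp
  have P\<^sub>X\<^sub>Y: "P\<^sub>X\<^sub>Y \<in> finite_moment_measures p" "wasserstein_le p (K\<^sub>X\<^sub>Y z\<^sub>0) P\<^sub>X\<^sub>Y (L\<^sub>X\<^sub>Y * d)"
    unfolding P\<^sub>X\<^sub>Y_def
    by (rule lipschitz_law_given_event[OF p M XY Z K\<^sub>X\<^sub>Y bin z\<^sub>0 d(2) moment_XY[unfolded S_def] lipschitz_XY[unfolded S_def]]; assumption)+
  have P\<^sub>X: "P\<^sub>X \<in> finite_moment_measures p" "wasserstein_le p (K\<^sub>X z\<^sub>0) P\<^sub>X (L\<^sub>X * d)"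
    unfolding P\<^sub>X_def
    by (rule lipschitz_law_given_event[OF p M X Z K\<^sub>X bin z\<^sub>0 d(2) moment_X[unfolded S_def] lipschitz_X[unfolded S_def]]; assumption)+
  have P\<^sub>Y: "P\<^sub>Y \<in> finite_moment_measures p" "wasserstein_le p (K\<^sub>Y z\<^sub>0) P\<^sub>Y (L\<^sub>Y * d)"
    unfolding P\<^sub>Y_def
    by (rule lipschitz_law_given_event[OF p M Y Z K\<^sub>Y bin z\<^sub>0 d(2) moment_Y[unfolded S_def] lipschitz_Y[unfolded S_def]]; assumption)+
  define C where "C = (2 powr (p - 1) * (L\<^sub>X powr p + L\<^sub>Y powr p)) powr (1 / p)"
  have C: "0 \<le> C" by (simp add: C_def)
  \<comment> \<open>The constant is homogeneous of degree one in the two Lipschitz constants, so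
    \<open>d\<close> factors out.\<close>
  have "(2 powr (p - 1) * ((L\<^sub>X * d) powr p + (L\<^sub>Y * d) powr p)) powr (1 / p) = C * d"
  proof -
    have "2 powr (p - 1) * ((L\<^sub>X * d) powr p + (L\<^sub>Y * d) powr p) =
        (2 powr (p - 1) * (L\<^sub>X powr p + L\<^sub>Y powr p)) * d powr p"
      using L_nonneg d(1) by (simp add: powr_mult algebra_simps)
    then show ?thesis using p d(1) by (simp add: C_def powr_mult powr_powr)
  qed
  then have prod: "wasserstein_le p (K\<^sub>X z\<^sub>0 \<Otimes>\<^sub>M K\<^sub>Y z\<^sub>0) (P\<^sub>X \<Otimes>\<^sub>M P\<^sub>Y) (C * d)"
    using wasserstein_le_product[OF p _ _ P\<^sub>X(2) P\<^sub>Y(2)] L_nonneg d(1) by simp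
  have small: "L\<^sub>X\<^sub>Y * d \<le> \<epsilon> / 4" "C * d \<le> \<epsilon> / 4"
  proof -
    have D: "L\<^sub>X\<^sub>Y \<le> D" "C \<le> D" by (simp_all add: D_def C_def)
    have "D * d \<le> \<epsilon> / 4"
    \<comment> \<open>For \<open>D = 0\<close> the diameter condition is void, but then
      \<open>D * d\<close> vanishes whatever the size of the bin. Otherwise \<open>D\<close> is
      positive because it dominates \<open>C\<close>.\<close>
    proof (cases "D = 0")
      case False
      then have "0 < D" using D C by simp
      moreover have "d \<le> \<epsilon> / (4 * D)" using bins_diameter[OF j False] by (simp add: d_def)
      ultimately show ?thesis by (simp add: field_simps)
    qed (use \<epsilon> in simp)
    then show "L\<^sub>X\<^sub>Y * d \<le> \<epsilon> / 4" "C * d \<le> \<epsilon> / 4"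
      using mult_right_mono[OF D(1) d(1)] mult_right_mono[OF D(2) d(1)] by linarith+
  qed
  have nonneg: "0 \<le> L\<^sub>X\<^sub>Y * d" "0 \<le> C * d" using L_nonneg C d(1) by simp_all
  have prod\<^sub>0: "K\<^sub>X z\<^sub>0 \<Otimes>\<^sub>M K\<^sub>Y z\<^sub>0 \<in> finite_moment_measures p"
    by (rule product_finite_moment[OF p moment_X[OF z\<^sub>0_S] moment_Y[OF z\<^sub>0_S]])
  have prod\<^sub>V: "P\<^sub>X \<Otimes>\<^sub>M P\<^sub>Y \<in> finite_moment_measures p"
    by (rule product_finite_moment[OF p P\<^sub>X(1) P\<^sub>Y(1)])
  have "\<bar>wasserstein p (K\<^sub>X\<^sub>Y z\<^sub>0) (K\<^sub>X z\<^sub>0 \<Otimes>\<^sub>M K\<^sub>Y z\<^sub>0) - wasserstein p P\<^sub>X\<^sub>Y (P\<^sub>X \<Otimes>\<^sub>M P\<^sub>Y)\<bar> \<le> L\<^sub>X\<^sub>Y * d + C * d"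
    by (rule wasserstein_perturbation[OF p nonneg moment_XY[OF z\<^sub>0_S] prod\<^sub>0 P\<^sub>X\<^sub>Y(1) prod\<^sub>V P\<^sub>X\<^sub>Y(2) prod])
  then show "\<bar>wasserstein p (K\<^sub>X\<^sub>Y z\<^sub>0) (K\<^sub>X z\<^sub>0 \<Otimes>\<^sub>M K\<^sub>Y z\<^sub>0) -
     wasserstein p
       (law_given_event M (\<lambda>w. (X w, Y w)) Z (V j))
       (law_given_event M X Z (V j) \<Otimes>\<^sub>M law_given_event M Y Z (V j))\<bar> \<le> \<epsilon> / 2"
    using small unfolding P\<^sub>X\<^sub>Y_def P\<^sub>X_def P\<^sub>Y_def by linarith
qed

end
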